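(* For every pair of integers $n$ and $k$ with $k\geq n\geq 2$, there exists a graph $G$ with clique number $n$ and chromatic number $k$ such that every induced subgraph of $G$ with clique number $m<n$ has chromatic number at most $\binom{3m+1}{3}$.
   Context: Graphs are finite and simple. *)

theory Defs
  imports "HOL-Library.Ramsey"
begin

text \<open>A graph is given by its vertex set \<open>V\<close> and its set \<open>E\<close> of edges, each edge being a
  two-element subset of \<open>V\<close>. This is the encoding used by \<^const>\<open>clique\<close> and \<^const>\<open>indep\<close>.\<close>

definition finite_simple_graph :: "'a set \<Rightarrow> 'a set set \<Rightarrow> bool" where
  "finite_simple_graph V E \<longleftrightarrow> finite V \<and> E \<subseteq> [V]\<^bsup>2\<^esup>"

definition induced_subgraph :: "'a set \<Rightarrow> 'a set set \<Rightarrow> 'a set \<Rightarrow> 'a set set \<Rightarrow> bool" where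
  "induced_subgraph W F V E \<longleftrightarrow> W \<subseteq> V \<and> F = {e \<in> E. e \<subseteq> W}"

definition clique_number :: "'a set \<Rightarrow> 'a set set \<Rightarrow> nat" where
  "clique_number V E = Max {card K | K. K \<subseteq> V \<and> clique K E}"

definition proper_colouring :: "'a set \<Rightarrow> 'a set set \<Rightarrow> nat \<Rightarrow> ('a \<Rightarrow> nat) \<Rightarrow> bool" where
  "proper_colouring V E k c \<longleftrightarrow>
     (\<forall>v\<in>V. c v < k) \<and> (\<forall>v\<in>V. \<forall>w\<in>V. {v, w} \<in> E \<longrightarrow> c v \<noteq> c w)"

definition chromatic_number :: "'a set \<Rightarrow> 'a set set \<Rightarrow> nat" where
  "chromatic_number V E = (LEAST k. \<exists>c. proper_colouring V E k c)"

text \<open>For finite simple graphs the maximum and the minimum above are attained, so neither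
  \<^const>\<open>clique_number\<close> nor \<^const>\<open>chromatic_number\<close> takes an unspecified value.\<close>

lemma finite_simple_graph_induced:
  assumes "finite_simple_graph V E" and "induced_subgraph W F V E"
  shows "finite_simple_graph W F"
  using assms
  by (auto simp: finite_simple_graph_def induced_subgraph_def nsets_def intro: finite_subset)

lemma clique_number_attained:
  assumes "finite_simple_graph V E"
  shows "\<exists>K. K \<subseteq> V \<and> clique K E \<and> card K = clique_number V E"
    and "\<And>K. K \<subseteq> V \<Longrightarrow> clique K E \<Longrightarrow> card K \<le> clique_number V E"
proof -
  let ?S = "{card K | K. K \<subseteq> V \<and> clique K E}"
  have "?S \<subseteq> card ` Pow V"
    by auto
  then have fin: "finite ?S"
    using assms finite_subset by (auto simp: finite_simple_graph_def)
  have "?S \<noteq> {}"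
    using null_clique by blast
  with fin have "Max ?S \<in> ?S"
    by (rule Max_in)
  then show "\<exists>K. K \<subseteq> V \<and> clique K E \<and> card K = clique_number V E"
    unfolding clique_number_def by auto
  show "card K \<le> clique_number V E" if "K \<subseteq> V" "clique K E" for K
    unfolding clique_number_def using fin that by (auto intro!: Max_ge)
qed

lemma chromatic_number_attained:
  assumes "finite_simple_graph V E"
  shows "\<exists>c. proper_colouring V E (chromatic_number V E) c"
    and "\<And>k c. proper_colouring V E k c \<Longrightarrow> chromatic_number V E \<le> k"
proof -
  have "finite V" and E: "E \<subseteq> [V]\<^bsup>2\<^esup>"
    using assms by (auto simp: finite_simple_graph_def)
  then obtain c where c: "bij_betw c V {0..<card V}"
    using ex_bij_betw_finite_nat by blast
  have "c v < card V" if "v \<in> V" for v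
    using c that by (auto simp: bij_betw_def)
  moreover have "c v \<noteq> c w" if "v \<in> V" "w \<in> V" "{v, w} \<in> E" for v w
  proof -
    have "v \<noteq> w"
      using E that by (auto simp: nsets_def)
    then show ?thesis
      using c that by (auto simp: bij_betw_def inj_on_def)
  qed
  ultimately have "\<exists>c. proper_colouring V E (card V) c"
    unfolding proper_colouring_def by blast
  then show "\<exists>c. proper_colouring V E (chromatic_number V E) c"
    unfolding chromatic_number_def by (rule LeastI)
  show "chromatic_number V E \<le> k" if "proper_colouring V E k c" for k c
    unfolding chromatic_number_def using that by (blast intro: Least_le)
qed

end

theory Submission
  imports Defs Complex_Main "HOL-Computational_Algebra.Primes" "HOL-Library.Countable_Set"
begin

text \<open>Zykov's construction gives a finite partial order in which any two comparable elements
  \<open>u < v\<close> have a length \<open>len u v\<close>, additive along chains, such that the graph of the pairs of length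
  \<open>1\<close> has chromatic number as large as desired. (The order is reachability in an acyclic digraph with
  at most one directed path between any two vertices; the length is that of the path.)

  Choose a prime \<open>p\<close> with \<open>2 n \<le> p < 3 n\<close> and join \<open>u < v\<close> whenever \<open>len u v\<close> is congruent modulo \<open>p\<close>
  to a nonzero number of absolute value less than \<open>n\<close>. A clique is a chain, and the lengths measured
  from its least element place it injectively on a cycle of \<open>p\<close> points, with all circular distances
  less than \<open>n\<close>. As \<open>2 n \<le> p\<close>, it has at most \<open>n\<close> elements.

  Now let \<open>S\<close> be a set of vertices with clique number \<open>m < n\<close>. Consider the larger graph that joins
  \<open>u < v\<close> whenever \<open>p\<close> does not divide \<open>len u v\<close>. A clique \<open>X\<close> of it in \<open>S\<close> also has distinct positions
  on the cycle, and each of the \<open>p\<close> windows of \<open>n\<close> consecutive points cuts out a clique of the original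
  graph, so counting gives \<open>card X * n \<le> p * m\<close>. Since \<open>p < 3 n\<close> and \<open>m < n\<close>, this means
  \<open>card X \<le> M\<close> for some \<open>M \<le> 3 m - 1\<close> with \<open>M < p\<close>.

  It remains to colour \<open>S\<close>, in the larger graph, with \<open>(M + 2) choose 3\<close> colours
  (\<open>colour_of_small_chains\<close>). By induction on \<open>M\<close> it suffices to colour the set \<open>T\<close> of the least elements
  of the cliques of size \<open>M\<close> with \<open>(M + 1) choose 2\<close> colours (\<open>colour_chain_minima\<close>). For \<open>v\<close> in \<open>T\<close> let
  \<open>B v\<close> be the set of residues of \<open>len u v\<close> for \<open>u \<le> v\<close> in \<open>T\<close>. Such a \<open>u < v\<close> cannot be added to a
  clique \<open>X\<close> of size \<open>M\<close> with least element \<open>v\<close>, so the residue of \<open>len u v\<close> is that of \<open>- len v x\<close> for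
  some \<open>x\<close> in \<open>X\<close>, whence \<open>card (B v) \<le> M\<close>. If \<open>u < v\<close> are joined and \<open>r\<close> is the residue of
  \<open>len u v\<close>, then \<open>B u + r \<subseteq> B v\<close>; so either \<open>B v\<close> is larger than \<open>B u\<close>, or it is the translate by \<open>r\<close>.
  As \<open>p\<close> is prime and the size \<open>i\<close> of a set \<open>B v\<close> satisfies \<open>0 < i < p\<close>, its translates are all
  distinct, and the place of \<open>0\<close> in \<open>B v\<close>, relative to the translation class, is one of \<open>i\<close> values and
  tells \<open>u\<close> from \<open>v\<close>. Altogether \<open>1 + \<dots> + M\<close> colours suffice.

  The prime \<open>p\<close> is found by the method of Erdos: without a prime between \<open>2 n\<close> and \<open>3 n\<close> the prime
  factorisation of \<open>3 n choose n\<close> would be too small. Finally, if the order is chosen with chromatic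
  number exceeding both \<open>k\<close> and the bound for cliques of fewer than \<open>n\<close> elements, its graph contains a
  clique of size \<open>n\<close>, and a minimal set of vertices that contains this clique and is not colourable with
  \<open>k - 1\<close> colours has chromatic number exactly \<open>k\<close>.\<close>

section \<open>A prime between \<open>2 n\<close> and \<open>3 n\<close>\<close>

lemma multiplicity_eq_card_dvd_powers:
  fixes p m N :: nat
  assumes "prime p" and "0 < m" and "m < p ^ Suc N"
  shows "multiplicity p m = card {i \<in> {1..N}. p ^ i dvd m}"
proof -
  have dvd_iff: "p ^ i dvd m \<longleftrightarrow> i \<le> multiplicity p m" for i
    using assms by (intro power_dvd_iff_le_multiplicity) (auto simp: prime_gt_1_nat)
  have "p ^ multiplicity p m \<le> m"
    using assms(2) by (intro dvd_imp_le multiplicity_dvd)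
  then have "p ^ multiplicity p m < p ^ Suc N"
    using assms(3) by linarith
  then have "multiplicity p m \<le> N"
    using prime_gt_1_nat[OF assms(1)] by (simp add: power_strict_increasing_iff del: power_Suc)
  then have "{i \<in> {1..N}. p ^ i dvd m} = {1..multiplicity p m}"
    unfolding dvd_iff by auto
  then show ?thesis
    by simp
qed

text \<open>Legendre's formula. The number \<open>N\<close> of summands is a parameter, which has only to be large
  enough, so that several factorials can be treated with the same range of exponents.\<close>

lemma multiplicity_fact_eq_sum:
  fixes p n N :: nat
  assumes "prime p" and "n < p ^ Suc N"
  shows "multiplicity p (fact n :: nat) = (\<Sum>i = 1..N. n div p ^ i)"
  using assms(2)
proof (induction n)
  case (Suc n)
  have "multiplicity p (fact (Suc n) :: nat) = multiplicity p (Suc n) + multiplicity p (fact n :: nat)"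
    using assms(1) by (subst fact_Suc, subst of_nat_id, intro prime_elem_multiplicity_mult_distrib) auto
  also have "\<dots> = card {i \<in> {1..N}. p ^ i dvd Suc n} + (\<Sum>i = 1..N. n div p ^ i)"
    using Suc by (simp add: multiplicity_eq_card_dvd_powers[OF assms(1)] del: power_Suc)
  also have "card {i \<in> {1..N}. p ^ i dvd Suc n} = (\<Sum>i = 1..N. if p ^ i dvd Suc n then 1 else 0)"
    by (simp add: sum.If_cases Int_def)
  also have "\<dots> + (\<Sum>i = 1..N. n div p ^ i) = (\<Sum>i = 1..N. Suc n div p ^ i)"
    unfolding sum.distrib[symmetric] div_Suc mod_eq_0_iff_dvd by (intro sum.cong) auto
  finally show ?case .
qed simp

lemma div_add_div_le: "a div q + b div q \<le> (a + b) div q" for a b q :: nat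
  by (subst div_add1_eq) simp

lemma multiplicity_choose_eq_sum:
  fixes p a b N :: nat
  assumes "prime p" and "a + b < p ^ Suc N"
  shows "multiplicity p ((a + b) choose a)
    = (\<Sum>i = 1..N. (a + b) div p ^ i - (a div p ^ i + b div p ^ i))"
proof -
  have "fact (a + b) = (fact a * fact b * ((a + b) choose a) :: nat)"
    using binomial_fact_lemma[of a "a + b"] by simp
  then have "multiplicity p (fact (a + b) :: nat)
      = multiplicity p (fact a :: nat) + multiplicity p (fact b :: nat) + multiplicity p ((a + b) choose a)"
    using assms(1) by (simp add: prime_elem_multiplicity_mult_distrib)
  moreover have "a < p ^ Suc N" "b < p ^ Suc N"
    using assms(2) by linarith+
  ultimately have "(\<Sum>i = 1..N. (a + b) div p ^ i)
      = (\<Sum>i = 1..N. a div p ^ i + b div p ^ i) + multiplicity p ((a + b) choose a)"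
    using assms by (simp add: multiplicity_fact_eq_sum sum.distrib del: power_Suc)
  moreover have "(\<Sum>i = 1..N. (a + b) div p ^ i - (a div p ^ i + b div p ^ i))
      = (\<Sum>i = 1..N. (a + b) div p ^ i) - (\<Sum>i = 1..N. a div p ^ i + b div p ^ i)"
    by (intro sum_subtractf_nat div_add_div_le)
  ultimately show ?thesis
    by simp
qed

lemma div_add_sub_le_1: "(a + b) div q - (a div q + b div q) \<le> 1" for a b q :: nat
proof (cases "q = 0")
  case False
  then have "a mod q + b mod q < 2 * q"
    by (metis add_less_mono mod_less_divisor mult_2 not_gr_zero)
  then have "(a mod q + b mod q) div q < 2"
    by (rule less_mult_imp_div_less)
  then show ?thesis
    by (subst div_add1_eq) simp
qed simp

lemma prime_power_multiplicity_choose_le: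
  fixes p a b :: nat
  assumes "prime p" and "0 < a + b"
  shows "p ^ multiplicity p ((a + b) choose a) \<le> a + b"
proof -
  obtain N where N: "p ^ N \<le> a + b" "a + b < p ^ Suc N"
    using ex_power_ivl1[of p "a + b"] assms prime_ge_2_nat[OF assms(1)] by auto
  have "multiplicity p ((a + b) choose a) \<le> (\<Sum>i = 1..N. 1)"
    unfolding multiplicity_choose_eq_sum[OF assms(1) N(2)] by (intro sum_mono div_add_sub_le_1)
  then have "p ^ multiplicity p ((a + b) choose a) \<le> p ^ N"
    using prime_gt_0_nat[OF assms(1)] by (intro power_increasing) auto
  with N(1) show ?thesis
    by linarith
qed

lemma prime_dvd_choose:
  fixes p a b :: nat
  assumes "prime p" and "a div p + b div p < (a + b) div p"
  shows "p dvd ((a + b) choose a)"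
proof -
  obtain N where N: "a + b < p ^ N"
    using power_gt_expt[OF prime_gt_Suc_0_nat[OF assms(1)]] by blast
  have "N \<noteq> 0"
    using N assms(2) by (metis add_is_0 div_0 less_one nat_less_le power_0)
  then obtain M where M: "N = Suc M"
    using not0_implies_Suc by blast
  have "M \<noteq> 0"
    using N M assms(2) by (auto intro: ccontr)
  have "(a + b) div p ^ 1 - (a div p ^ 1 + b div p ^ 1) \<le> multiplicity p ((a + b) choose a)"
    unfolding multiplicity_choose_eq_sum[OF assms(1) N[unfolded M]]
    using \<open>M \<noteq> 0\<close> by (intro member_le_sum) auto
  then have "0 < multiplicity p ((a + b) choose a)"
    using assms(2) by simp
  then show ?thesis
    using not_dvd_imp_multiplicity_0 by fastforce
qed

lemma multiplicity_choose_of_less_square: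
  fixes p a b :: nat
  assumes "prime p" and "a + b < p\<^sup>2"
  shows "multiplicity p ((a + b) choose a) = (a + b) div p - (a div p + b div p)"
  using multiplicity_choose_eq_sum[of p a b 1] assms by (simp add: power2_eq_square)

lemma prod_primes_dvd:
  fixes m :: nat
  assumes "finite A" and "\<And>p. p \<in> A \<Longrightarrow> prime p \<and> p dvd m"
  shows "\<Prod>A dvd m"
  using assms
proof (induction A)
  case (insert q A)
  have "coprime q (\<Prod>A)"
    using insert by (intro prod_coprime_right) (auto intro: primes_coprime)
  with insert show ?case
    by (simp add: divides_mult)
qed simp

lemma primorial_le: "\<Prod>{p. prime p \<and> p \<le> n} \<le> (4 :: nat) ^ n"
proof (induction n rule: less_induct)
  case (less n)
  consider "n \<le> 2" | "even n" "2 < n" | "odd n" "2 < n"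
    by linarith
  then show ?case
  proof cases
    case 1
    then have "{p. prime p \<and> p \<le> n} = (if n = 2 then {2} else {})"
      by (auto dest!: prime_ge_2_nat)
    then show ?thesis
      by simp
  next
    case 2
    have "\<not> prime n"
      using 2 primes_dvd_imp_eq two_is_prime_nat by blast
    then have "p \<le> n \<longleftrightarrow> p \<le> n - 1" if "prime p" for p
      using that by (cases "p = n") auto
    then have "{p. prime p \<and> p \<le> n} = {p. prime p \<and> p \<le> n - 1}"
      by auto
    also have "\<Prod>\<dots> \<le> (4 :: nat) ^ (n - 1)"
      using 2 by (intro less) auto
    also have "(4 :: nat) ^ (n - 1) \<le> 4 ^ n"
      by (intro power_increasing) auto
    finally show ?thesis .
  next
    case 3
    then obtain m where m: "n = 2 * m + 1" "0 < m"
      by (auto elim!: oddE)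
    let ?A = "{p. prime p \<and> p \<le> m + 1}" and ?B = "{p. prime p \<and> m + 1 < p \<and> p \<le> n}"
    have split: "{p. prime p \<and> p \<le> n} = ?A \<union> ?B"
      using m by auto
    have fin: "finite ?A" "finite ?B"
      by auto
    have "\<Prod>?B dvd (2 * m + 1 choose m)"
    proof (intro prod_primes_dvd conjI fin)
      fix p assume p: "p \<in> ?B"
      then show "prime p" by simp
      have "m div p + (m + 1) div p < (m + (m + 1)) div p"
        using p m by (simp add: div_greater_zero_iff)
      then show "p dvd (2 * m + 1 choose m)"
        using prime_dvd_choose[of p m "m + 1"] p by (simp add: mult_2)
    qed
    then have "\<Prod>?B \<le> (2 * m + 1 choose m)"
      by (intro dvd_imp_le) auto
    also have "\<dots> \<le> 4 ^ m"
    proof -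
      have "(\<Sum>i\<in>{m, m + 1}. 2 * m + 1 choose i) \<le> (\<Sum>i\<le>2 * m + 1. 2 * m + 1 choose i)"
        by (intro sum_mono2) auto
      moreover have "(2 * m + 1 choose (m + 1)) = (2 * m + 1 choose m)"
        by (subst binomial_symmetric) auto
      ultimately show ?thesis
        using choose_row_sum[of "2 * m + 1"] by (simp add: power_mult)
    qed
    finally have "\<Prod>?A * \<Prod>?B \<le> 4 ^ (m + 1) * 4 ^ m"
      using m by (intro mult_mono less) auto
    then show ?thesis
      unfolding split using m by (subst prod.union_disjoint) (auto simp: power_add mult_2)
  qed
qed

lemma choose_third_Suc:
  "(3 * Suc n choose Suc n) * (2 * (n + 1) * (2 * n + 1)) = (3 * n choose n) * (3 * (3 * n + 2) * (3 * n + 1))"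
proof -
  have f: "fact n * fact (2 * n) * (3 * n choose n) = (fact (3 * n) :: nat)"
    using binomial_fact_lemma[of n "3 * n"] by simp
  have "fact (Suc n) * fact (2 * Suc n) * (3 * Suc n choose Suc n) = (fact (3 * Suc n) :: nat)"
    using binomial_fact_lemma[of "Suc n" "3 * Suc n"] by simp
  moreover have "(fact (Suc n) :: nat) = (n + 1) * fact n"
    by simp
  moreover have "(fact (2 * Suc n) :: nat) = 2 * (n + 1) * (2 * n + 1) * fact (2 * n)"
    by (simp add: algebra_simps)
  moreover have "(fact (3 * Suc n) :: nat) = 3 * (n + 1) * (3 * n + 2) * (3 * n + 1) * fact (3 * n)"
    by (simp add: eval_nat_numeral algebra_simps)
  ultimately have "((n + 1) * fact n) * (2 * (n + 1) * (2 * n + 1) * fact (2 * n)) * (3 * Suc n choose Suc n)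
      = 3 * (n + 1) * (3 * n + 2) * (3 * n + 1) * (fact n * fact (2 * n) * (3 * n choose n))"
    unfolding f by (simp only:)
  then have "((n + 1) * fact n * fact (2 * n)) * ((3 * Suc n choose Suc n) * (2 * (n + 1) * (2 * n + 1)))
      = ((n + 1) * fact n * fact (2 * n)) * ((3 * n choose n) * (3 * (3 * n + 2) * (3 * n + 1)))"
    by (simp only: mult_ac)
  then show ?thesis
    by (subst (asm) mult_left_cancel) auto
qed

lemma choose_third_upper: "(3 * n choose n) * 4 ^ n \<le> 27 ^ n"
proof (induction n)
  case (Suc n)
  let ?d = "2 * (n + 1) * (2 * n + 1)"
  have "?d * ((3 * Suc n choose Suc n) * 4 ^ Suc n)
      = ((3 * n choose n) * 4 ^ n) * (12 * (3 * n + 2) * (3 * n + 1))"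
    using choose_third_Suc[of n] by (simp add: mult_ac)
  also have "\<dots> \<le> 27 ^ n * (27 * ?d)"
    by (rule mult_mono[OF Suc.IH]) (auto simp: algebra_simps)
  finally have "?d * ((3 * Suc n choose Suc n) * 4 ^ Suc n) \<le> ?d * 27 ^ Suc n"
    by (simp only: power_Suc mult_ac)
  then show ?case
    by (subst (asm) mult_le_cancel1) auto
qed simp

lemma choose_third_lower:
  assumes "1 \<le> n"
  shows "4 * 27 ^ n \<le> (3 * n choose n) * 4 ^ n * (9 * n)"
  using assms
proof (induction n rule: dec_induct)
  case (step n)
  let ?d = "2 * (n + 1) * (2 * n + 1)"
  have "?d * (4 * 27 ^ Suc n) = (4 * 27 ^ n) * (27 * ?d)"
    by (simp only: power_Suc mult_ac)
  also have "\<dots> \<le> ((3 * n choose n) * 4 ^ n * (9 * n)) * (27 * ?d)"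
    by (intro mult_right_mono step.IH) auto
  also have "\<dots> = ((3 * n choose n) * 4 ^ n) * (9 * n * 27 * ?d)"
    by (simp only: mult_ac)
  also have "\<dots> \<le> ((3 * n choose n) * 4 ^ n) * (4 * (9 * Suc n) * (3 * (3 * n + 2) * (3 * n + 1)))"
    by (intro mult_left_mono) (auto simp: algebra_simps)
  also have "\<dots> = ((3 * n choose n) * (3 * (3 * n + 2) * (3 * n + 1))) * 4 ^ Suc n * (9 * Suc n)"
    by (simp only: power_Suc mult_ac)
  also have "\<dots> = ?d * ((3 * Suc n choose Suc n) * 4 ^ Suc n * (9 * Suc n))"
    unfolding choose_third_Suc[symmetric] by (simp only: mult_ac)
  finally show ?case
    by (subst (asm) mult_le_cancel1) auto
qed (simp add: numeral_eq_Suc)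

text \<open>The main estimate. A prime \<open>p\<close> that divides \<open>3 n choose n\<close> and whose square exceeds \<open>3 n\<close> divides
  it exactly once, and then, unless \<open>2 n < p \<le> 3 n\<close>, it satisfies \<open>n < p \<le> 3 n / 2\<close> or \<open>p \<le> 3 n / 4\<close>. With
  \<open>k\<close> about \<open>n / 2\<close>, those greater than \<open>k\<close> lie in \<open>(2 k, 3 k]\<close> or \<open>(k, 3 k / 2]\<close> (the
  rounding of \<open>k\<close> may lose \<open>p = n + 1\<close>) and hence divide \<open>3 k choose k\<close>; the others are accounted for by
  \<open>\<Prod>{p. prime p \<and> p \<le> k} \<le> 4 ^ k\<close>. The primes \<open>p\<close> with \<open>p\<^sup>2 \<le> 3 n\<close> are at most \<open>Y\<close> in number and contribute at
  most \<open>3 n\<close> each.\<close>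

lemma choose_third_le_of_no_prime:
  fixes n Y k :: nat
  assumes "1 \<le> n" and Y: "3 * n < (Suc Y)\<^sup>2"
    and no_prime: "\<And>p. prime p \<Longrightarrow> 2 * n < p \<Longrightarrow> 3 * n < p"
  defines "k \<equiv> Suc n div 2"
  shows "(3 * n choose n) \<le> (3 * n) ^ Y * (n + 1) * (3 * k choose k) * 4 ^ k"
proof -
  define C where "C = (n + 2 * n choose n)"
  have C: "(3 * n choose n) = C" "C \<noteq> 0"
    by (auto simp: C_def)
  have k: "n \<le> 2 * k" "2 * k \<le> n + 1"
    by (auto simp: k_def)
  define A where "A = {p \<in> prime_factors C. p\<^sup>2 \<le> 3 * n}"
  define B where "B = {p \<in> prime_factors C. 3 * n < p\<^sup>2}"
  define D where "D = {p \<in> B. p dvd (3 * k choose k)}"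
  have fin: "finite A" "finite B" "finite D"
    by (auto simp: A_def B_def D_def)
  have C_prod: "C = (\<Prod>p\<in>A. p ^ multiplicity p C) * (\<Prod>p\<in>B. p ^ multiplicity p C)"
  proof -
    have "C = (\<Prod>p\<in>A \<union> B. p ^ multiplicity p C)"
    proof -
      have "A \<union> B = prime_factors C"
        by (auto simp: A_def B_def)
      then show ?thesis
        using prime_factorization_nat[of C] C(2) by simp
    qed
    also have "\<dots> = (\<Prod>p\<in>A. p ^ multiplicity p C) * (\<Prod>p\<in>B. p ^ multiplicity p C)"
      using fin by (intro prod.union_disjoint) (auto simp: A_def B_def)
    finally show ?thesis .
  qed
  have "A \<subseteq> {1..Y}"
  proof
    fix p assume p: "p \<in> A"
    then have "p\<^sup>2 < (Suc Y)\<^sup>2"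
      using Y by (simp add: A_def)
    then have "p \<le> Y"
      using power_less_imp_less_base by fastforce
    then show "p \<in> {1..Y}"
      using p prime_ge_1_nat[of p] by (auto simp: A_def)
  qed
  then have "card A \<le> Y"
    using card_mono[of "{1..Y}" A] by simp
  have "(\<Prod>p\<in>A. p ^ multiplicity p C) \<le> (\<Prod>p\<in>A. 3 * n)"
    using assms(1) prime_power_multiplicity_choose_le[of _ n "2 * n"]
    by (intro prod_mono) (auto simp: A_def C_def)
  also have "\<dots> \<le> (3 * n) ^ Y"
    using assms(1) \<open>card A \<le> Y\<close> unfolding prod_constant by (intro power_increasing) auto
  finally have A_le: "(\<Prod>p\<in>A. p ^ multiplicity p C) \<le> (3 * n) ^ Y" .

  have mult_B: "multiplicity p C = 3 * n div p - (n div p + 2 * n div p)" "prime p" "0 < multiplicity p C"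
    if "p \<in> B" for p
    using multiplicity_choose_of_less_square[of p n "2 * n"] that C(2)
    by (auto simp: B_def C_def prime_factors_multiplicity)
  have le_1: "3 * n div q - (n div q + 2 * n div q) \<le> 1" for q
    using div_add_sub_le_1[of n "2 * n" q] by simp
  have "(\<Prod>p\<in>B. p ^ multiplicity p C) = \<Prod>B"
    using mult_B le_1 by (intro prod.cong refl) (metis One_nat_def Suc_leI le_antisym power_one_right)
  also have "\<Prod>B = \<Prod>D * \<Prod>(B - D)"
    using fin by (subst prod.subset_diff[of D B]) (auto simp: D_def mult.commute)
  also have "\<Prod>D \<le> (3 * k choose k)"
    using fin by (intro dvd_imp_le prod_primes_dvd) (auto simp: D_def mult_B)
  also have "\<Prod>(B - D) \<le> \<Prod>(insert (n + 1) {p. prime p \<and> p \<le> k})"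
  proof (intro dvd_imp_le prod_dvd_prod_subset)
    show "B - D \<subseteq> insert (n + 1) {p. prime p \<and> p \<le> k}"
    proof (rule subsetI, rule ccontr)
      fix p assume p: "p \<in> B - D" and "p \<notin> insert (n + 1) {p. prime p \<and> p \<le> k}"
      then have "prime p" and "k < p" and "p \<noteq> n + 1"
        using mult_B(2)[of p] by auto
      have not_dvd: "\<not> p dvd (k + 2 * k choose k)"
        using p by (auto simp: D_def)
      have less: "n div p + 2 * n div p < 3 * n div p"
        using mult_B[of p] p by auto
      then have "p \<le> 3 * n"
        by (metis div_less not_less_zero not_le)
      then have "p \<le> 2 * n"
        using no_prime[of p] \<open>prime p\<close> by linarith
      have "k div p = 0"
        using \<open>k < p\<close> by simp
      show False
      proof (cases "n < p")
        case True
        then have "n div p = 0" "2 * n div p = 1"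
          using \<open>p \<le> 2 * n\<close> by (auto intro!: div_nat_eqI)
        then have "2 \<le> 3 * n div p"
          using less by linarith
        then have "2 * p \<le> 3 * n"
          using \<open>prime p\<close> by (simp add: less_eq_div_iff_mult_less_eq prime_gt_0_nat)
        then have "1 \<le> (k + 2 * k) div p" "2 * k div p = 0"
          using True \<open>p \<noteq> n + 1\<close> k \<open>prime p\<close>
          by (auto simp: less_eq_div_iff_mult_less_eq prime_gt_0_nat Suc_le_eq div_greater_zero_iff)
        then show False
          using prime_dvd_choose[OF \<open>prime p\<close>, of k "2 * k"] not_dvd \<open>k div p = 0\<close> by simp
      next
        case False
        then have "n div p = 1" "2 \<le> 2 * n div p"
          using \<open>k < p\<close> k \<open>prime p\<close>
          by (auto intro!: div_nat_eqI simp: less_eq_div_iff_mult_less_eq prime_gt_0_nat)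
        then have "4 \<le> 3 * n div p"
          using less by linarith
        then have "4 * p \<le> 3 * n"
          using \<open>prime p\<close> by (simp add: less_eq_div_iff_mult_less_eq prime_gt_0_nat)
        then have "2 \<le> (k + 2 * k) div p"
          using k \<open>prime p\<close> by (simp add: less_eq_div_iff_mult_less_eq prime_gt_0_nat)
        moreover have "2 * k div p = 1"
          using False k \<open>k < p\<close> by (intro div_nat_eqI) auto
        ultimately show False
          using prime_dvd_choose[OF \<open>prime p\<close>, of k "2 * k"] not_dvd \<open>k div p = 0\<close> by simp
      qed
    qed
    show "0 < \<Prod>(insert (n + 1) {p. prime p \<and> p \<le> k})"
      by (intro prod_pos) (auto dest: prime_gt_0_nat)
  qed auto
  also have "\<dots> = (n + 1) * \<Prod>{p. prime p \<and> p \<le> k}"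
    using k assms(1) by (subst prod.insert) auto
  also have "\<dots> \<le> (n + 1) * 4 ^ k"
    by (intro mult_left_mono primorial_le) auto
  finally have B_le: "(\<Prod>p\<in>B. p ^ multiplicity p C) \<le> (3 * k choose k) * ((n + 1) * 4 ^ k)"
    by simp
  show ?thesis
    unfolding C(1) using mult_mono[OF A_le B_le] C_prod by (simp only: mult_ac)
qed

text \<open>This settles the comparison of \<open>(3 n) ^ Y\<close>, where \<open>Y\<close> is about \<open>sqrt (3 n)\<close>, with an exponential in \<open>n\<close>.\<close>

lemma power_17_le: "128 \<le> Y \<Longrightarrow> Suc Y ^ 17 \<le> (2 :: nat) ^ Y"
proof (induction Y rule: dec_induct)
  case (step Y)
  define x :: real where "x = Y + 2"
  have "1 / 2 \<le> 1 + real 17 * (- 1 / x)"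
    using step by (simp add: x_def field_simps)
  also have "\<dots> \<le> (1 + (- 1 / x)) ^ 17"
    using step by (intro Bernoulli_inequality) (simp add: x_def)
  also have "1 + (- 1 / x) = (x - 1) / x"
    using step by (simp add: x_def field_simps)
  finally have "x ^ 17 \<le> 2 * (x - 1) ^ 17"
    using step by (simp add: x_def field_simps)
  then have "real (Suc (Suc Y) ^ 17) \<le> real (2 * Suc Y ^ 17)"
    by (simp add: x_def add.commute)
  then have "Suc (Suc Y) ^ 17 \<le> 2 * Suc Y ^ 17"
    by (simp only: of_nat_le_iff)
  also have "\<dots> \<le> 2 ^ Suc Y"
    using step.IH by simp
  finally show ?case .
qed simp

lemma ex_square_ivl: "\<exists>Y. Y\<^sup>2 \<le> m \<and> m < (Suc Y)\<^sup>2" for m :: nat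
proof (induction m)
  case (Suc m)
  then obtain Y where "Y\<^sup>2 \<le> m" "m < (Suc Y)\<^sup>2"
    by blast
  then have "Y\<^sup>2 \<le> Suc m \<and> Suc m < (Suc Y)\<^sup>2 \<or> (Suc Y)\<^sup>2 \<le> Suc m \<and> Suc m < (Suc (Suc Y))\<^sup>2"
    by (auto simp: power2_eq_square)
  then show ?case
    by blast
qed simp

lemma prime_between_large:
  fixes n :: nat
  assumes "5462 \<le> n"
  shows "\<exists>p. prime p \<and> 2 * n < p \<and> p \<le> 3 * n"
proof (rule ccontr)
  assume "\<not> ?thesis"
  then have no_prime: "3 * n < p" if "prime p" "2 * n < p" for p
    using that by (meson not_le)
  obtain Y where Y: "Y\<^sup>2 \<le> 3 * n" "3 * n < (Suc Y)\<^sup>2"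
    using ex_square_ivl by blast
  \<comment> \<open>The threshold for \<open>n\<close> is the least with \<open>128\<^sup>2 \<le> 3 * n\<close>.\<close>
  have "128\<^sup>2 < (Suc Y)\<^sup>2"
    using Y(2) assms by simp
  then have "128 \<le> Y"
    using power_less_imp_less_base[of 128 2 "Suc Y"] by simp
  define Z where "Z = Suc Y"
  define k where "k = Suc n div 2"
  have Z: "129 \<le> Z" "3 * n < Z\<^sup>2"
    using \<open>128 \<le> Y\<close> Y by (auto simp: Z_def)

  let ?W = "(3 * n) ^ Y * (n + 1)"
  have sq: "(4 * 27 ^ n)\<^sup>2 = 27 ^ n * (16 * 27 ^ n :: nat)"
    by (simp add: power2_eq_square)
  \<comment> \<open>Up to polynomial factors, \<open>3 n choose n\<close> is \<open>(27 / 4) ^ n\<close>, while the absence of a prime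
    would bound it by \<open>(3 n) ^ Y * 27 ^ (n / 2)\<close>.\<close>
  have "4 * 27 ^ n \<le> (3 * n choose n) * 4 ^ n * (9 * n)"
    using assms by (intro choose_third_lower) simp
  also have "\<dots> \<le> (?W * (3 * k choose k) * 4 ^ k) * 4 ^ n * (9 * n)"
    using choose_third_le_of_no_prime[OF _ Y(2) no_prime] assms
    by (intro mult_right_mono) (auto simp: k_def)
  also have "\<dots> = (?W * 4 ^ n * (9 * n)) * ((3 * k choose k) * 4 ^ k)"
    by (simp only: mult_ac)
  also have "\<dots> \<le> (?W * 4 ^ n * (9 * n)) * 27 ^ k"
    by (intro mult_left_mono choose_third_upper) auto
  finally have "(4 * 27 ^ n)\<^sup>2 \<le> (?W * 4 ^ n * (9 * n) * 27 ^ k)\<^sup>2"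
    by (intro power_mono) auto
  also have "\<dots> = (?W * (9 * n))\<^sup>2 * 16 ^ n * 27 ^ (2 * k)"
  proof -
    have "(4 ^ n)\<^sup>2 = (16 :: nat) ^ n"
      by (simp add: power2_eq_square flip: power_mult_distrib)
    moreover have "(27 ^ k)\<^sup>2 = (27 :: nat) ^ (2 * k)"
      by (metis mult.commute power_mult)
    ultimately show ?thesis
      by (simp only: power_mult_distrib mult_ac)
  qed
  also have "\<dots> \<le> (?W * (9 * n))\<^sup>2 * 16 ^ n * 27 ^ Suc n"
    by (intro mult_left_mono power_increasing) (auto simp: k_def)
  also have "\<dots> = 27 ^ n * ((?W * (9 * n))\<^sup>2 * 27 * 16 ^ n)"
    by (simp only: power_Suc mult_ac)
  finally have "27 ^ n * (16 * 27 ^ n) \<le> 27 ^ n * ((?W * (9 * n))\<^sup>2 * 27 * 16 ^ n)"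
    unfolding sq .
  then have "16 * 27 ^ n \<le> (?W * (9 * n))\<^sup>2 * 27 * 16 ^ n"
    by (subst (asm) mult_le_cancel1) auto
  moreover have "(?W * (9 * n))\<^sup>2 * 27 \<le> Z ^ (4 * Y + 10)"
  proof -
    have "(3 * n) ^ Y \<le> (Z\<^sup>2) ^ Y"
      using Z(2) by (intro power_mono) auto
    moreover have "n + 1 \<le> Z\<^sup>2" "n \<le> Z\<^sup>2"
      using Z(2) assms by linarith+
    ultimately have "?W * n \<le> (Z\<^sup>2) ^ Y * Z\<^sup>2 * Z\<^sup>2"
      by (intro mult_mono) auto
    also have "\<dots> = Z ^ (2 * Y + 4)"
      by (simp only: power_mult[symmetric] power_add[symmetric]) (rule arg_cong[of _ _ "power Z"], simp)
    finally have "(?W * n)\<^sup>2 \<le> (Z ^ (2 * Y + 4))\<^sup>2"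
      by (intro power_mono) auto
    moreover have "2187 \<le> Z\<^sup>2"
      using power_mono[OF Z(1), of 2] by simp
    ultimately have "2187 * (?W * n)\<^sup>2 \<le> Z\<^sup>2 * (Z ^ (2 * Y + 4))\<^sup>2"
      by (intro mult_mono) auto
    also have "\<dots> = Z ^ (4 * Y + 10)"
      by (simp only: power_mult[symmetric] power_add[symmetric]) (rule arg_cong[of _ _ "power Z"], simp)
    finally have "2187 * (?W * n)\<^sup>2 \<le> Z ^ (4 * Y + 10)" .
    moreover have "2187 * (?W * n)\<^sup>2 = (?W * (9 * n))\<^sup>2 * 27"
    proof -
      have "2187 * (w * n)\<^sup>2 = (w * (9 * n))\<^sup>2 * 27" for w
        by (simp add: power2_eq_square)
      then show ?thesis .
    qed
    ultimately show ?thesis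
      by (simp only:)
  qed
  ultimately have "16 * 27 ^ n \<le> Z ^ (4 * Y + 10) * 16 ^ n"
    by (meson le_trans mult_le_mono1)
  then have "27 ^ n \<le> Z ^ (4 * Y + 10) * 16 ^ n"
    by linarith
  then have "(27 ^ n) ^ 4 \<le> (Z ^ (4 * Y + 10) * 16 ^ n) ^ 4"
    by (intro power_mono) auto
  also have "\<dots> = Z ^ (16 * Y + 40) * 65536 ^ n"
  proof -
    have "(16 ^ n) ^ 4 = ((16 ^ 4) ^ n :: nat)" "(Z ^ (4 * Y + 10)) ^ 4 = Z ^ (16 * Y + 40)"
      unfolding power_mult[symmetric] by (simp_all add: mult.commute add_mult_distrib)
    then show ?thesis
      unfolding power_mult_distrib by simp
  qed
  finally have upper: "(27 ^ n) ^ 4 \<le> Z ^ (16 * Y + 40) * 65536 ^ n" .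
  \<comment> \<open>\<open>27 ^ 4 = 531441\<close> is slightly larger than \<open>8 * 16 ^ 4 = 524288\<close>.\<close>
  have "8 ^ n * 65536 ^ n = (8 * 65536 :: nat) ^ n"
    by (rule power_mult_distrib[symmetric])
  also have "\<dots> \<le> (27 ^ 4) ^ n"
    by (intro power_mono) auto
  also have "\<dots> = (27 ^ n) ^ 4"
    unfolding power_mult[symmetric] by (simp only: mult.commute)
  also note upper
  finally have "8 ^ n \<le> Z ^ (16 * Y + 40)"
    by simp
  also have "\<dots> \<le> Z ^ (17 * (Y - 1))"
    using \<open>128 \<le> Y\<close> Z by (intro power_increasing) auto
  also have "\<dots> = (Z ^ 17) ^ (Y - 1)"
    by (rule power_mult)
  also have "\<dots> \<le> (2 ^ Y) ^ (Y - 1)"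
    using power_17_le[OF \<open>128 \<le> Y\<close>] by (intro power_mono) (auto simp: Z_def)
  also have "\<dots> = 2 ^ (Y * (Y - 1))"
    by (rule power_mult[symmetric])
  also have "\<dots> < 2 ^ Y\<^sup>2"
    using \<open>128 \<le> Y\<close> by (intro power_strict_increasing) (auto simp: power2_eq_square)
  also have "\<dots> \<le> 2 ^ (3 * n)"
    using Y(1) by (intro power_increasing) auto
  also have "\<dots> = 8 ^ n"
    by (simp add: power_mult)
  finally show False
    by simp
qed

lemma prime_by_trial:
  fixes p b :: nat
  assumes "1 < p" and "p < b\<^sup>2" and "\<forall>d \<in> set [2..<b]. \<not> d dvd p"
  shows "prime p"
proof (rule ccontr)
  assume "\<not> prime p"
  then obtain a where "a dvd p" "a \<noteq> 1" "a \<noteq> p"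
    using assms(1) by (auto simp: prime_nat_iff)
  moreover from this obtain c where "p = a * c"
    by blast
  ultimately have ac: "p = a * c" "1 < a" "1 < c"
    using assms(1) by (cases "a = 0"; cases "c = 0"; cases "c = 1"; simp)+
  have "b \<le> d" if "d dvd p" "1 < d" for d
  proof (rule ccontr)
    assume "\<not> b \<le> d"
    then have "d \<in> set [2..<b]"
      using \<open>1 < d\<close> by simp
    then show False
      using assms(3) \<open>d dvd p\<close> by blast
  qed
  then have "b \<le> a" "b \<le> c"
    using ac by auto
  then have "b * b \<le> p"
    unfolding ac(1) by (intro mult_mono) auto
  then show False
    using assms(2) by (simp add: power2_eq_square)
qed

text \<open>Each prime \<open>p\<close> used in the proof serves for \<open>p / 3 < n \<le> p / 2\<close>, and for consecutive ones these intervals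
  leave no gap.\<close>

lemma ex_prime_between_small:
  fixes n :: nat
  assumes "2 \<le> n" and "n < 5462"
  shows "\<exists>p. prime p \<and> 2 * n \<le> p \<and> p < 3 * n"
proof (rule ccontr)
  assume "\<not> ?thesis"
  then have up: "p < 2 * n" if "prime p" "p < 3 * n" for p
    using that by (meson not_le)
  have a5: "5 < 2 * n"
    using assms(1) by (intro up prime_by_trial[of _ 3]) simp_all
  have a7: "7 < 2 * n"
    using a5 by (intro up prime_by_trial[of _ 3]) simp_all
  have a11: "11 < 2 * n"
    using a7 by (intro up prime_by_trial[of _ 4]) simp_all
  have a17: "17 < 2 * n"
    using a11 by (intro up prime_by_trial[of _ 5]) simp_all
  have a23: "23 < 2 * n"
    using a17 by (intro up prime_by_trial[of _ 5]) simp_all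
  have a31: "31 < 2 * n"
    using a23 by (intro up prime_by_trial[of _ 6]) simp_all
  have a47: "47 < 2 * n"
    using a31 by (intro up prime_by_trial[of _ 7]) simp_all
  have a71: "71 < 2 * n"
    using a47 by (intro up prime_by_trial[of _ 9]) simp_all
  have a107: "107 < 2 * n"
    using a71 by (intro up prime_by_trial[of _ 11]) simp_all
  have a157: "157 < 2 * n"
    using a107 by (intro up prime_by_trial[of _ 13]) simp_all
  have a233: "233 < 2 * n"
    using a157 by (intro up prime_by_trial[of _ 16]) simp_all
  have a349: "349 < 2 * n"
    using a233 by (intro up prime_by_trial[of _ 19]) simp_all
  have a523: "523 < 2 * n"
    using a349 by (intro up prime_by_trial[of _ 23]) simp_all
  have a773: "773 < 2 * n"
    using a523 by (intro up prime_by_trial[of _ 28]) simp_all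
  have a1153: "1153 < 2 * n"
    using a773 by (intro up prime_by_trial[of _ 34]) simp_all
  have a1723: "1723 < 2 * n"
    using a1153 by (intro up prime_by_trial[of _ 42]) simp_all
  have a2579: "2579 < 2 * n"
    using a1723 by (intro up prime_by_trial[of _ 51]) simp_all
  have a3863: "3863 < 2 * n"
    using a2579 by (intro up prime_by_trial[of _ 63]) simp_all
  have a5791: "5791 < 2 * n"
    using a3863 by (intro up prime_by_trial[of _ 77]) simp_all
  have a8681: "8681 < 2 * n"
    using a5791 by (intro up prime_by_trial[of _ 94]) simp_all
  have a13009: "13009 < 2 * n"
    using a8681 by (intro up prime_by_trial[of _ 115]) simp_all
  with assms(2) show False
    by simp
qed

lemma ex_prime_between:
  fixes n :: nat
  assumes "2 \<le> n"
  shows "\<exists>p. prime p \<and> 2 * n \<le> p \<and> p < 3 * n"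
proof (cases "n < 5462")
  case True
  with assms show ?thesis
    by (rule ex_prime_between_small)
next
  case False
  then obtain p where p: "prime p" "2 * n < p" "p \<le> 3 * n"
    using prime_between_large[of n] by (auto simp: not_less)
  have "p \<noteq> 3 * n"
    using p(1) assms prime_product[of 3 n] by auto
  then have "2 * n \<le> p" "p < 3 * n"
    using p(2,3) by simp_all
  with p(1) show ?thesis
    by blast
qed

section \<open>An order with additive lengths and large chromatic number\<close>

text \<open>The vertices of Zykov's construction. Stage \<open>k + 1\<close> consists of \<open>k\<close> disjoint copies of stage \<open>k\<close> and,
  for each choice \<open>vs\<close> of one vertex from each copy, a new vertex \<open>Apex vs\<close> above the chosen vertices.\<close>

datatype zykov = Copy nat zykov | Apex "zykov list"

instance zykov :: countable
  by countable_datatype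

text \<open>The order generated by the arcs from the chosen vertices to their apex; \<open>Copy i u\<close> stands for the
  vertex \<open>u\<close> of the \<open>i\<close>-th copy.\<close>

fun zykov_less :: "zykov \<Rightarrow> zykov \<Rightarrow> bool" where
  "zykov_less (Copy i u) (Copy j v) \<longleftrightarrow> i = j \<and> zykov_less u v"
| "zykov_less (Copy i u) (Apex vs) \<longleftrightarrow> i < length vs \<and> (u = vs ! i \<or> zykov_less u (vs ! i))"
| "zykov_less (Apex us) v \<longleftrightarrow> False"

text \<open>The length of the directed path from the first to the second argument. Below \<open>Apex vs\<close>, such a path
  leaves the \<open>i\<close>-th copy through \<open>vs ! i\<close>. For incomparable arguments the value has no meaning.\<close>

fun zykov_len :: "zykov \<Rightarrow> zykov \<Rightarrow> nat" where
  "zykov_len (Copy i u) (Copy j v) = zykov_len u v"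
| "zykov_len (Copy i u) (Apex vs) = (if u = vs ! i then 1 else Suc (zykov_len u (vs ! i)))"
| "zykov_len (Apex us) v = 0"

text \<open>The vertices of stage \<open>k\<close>. Stage \<open>0\<close> is empty, so stage \<open>1\<close> has the single vertex \<open>Apex []\<close>.\<close>

fun zykov_verts :: "nat \<Rightarrow> zykov set" where
  "zykov_verts 0 = {}"
| "zykov_verts (Suc k) = (\<Union>i<k. Copy i ` zykov_verts k)
     \<union> Apex ` {vs. set vs \<subseteq> zykov_verts k \<and> length vs = k}"

lemma finite_zykov_verts: "finite (zykov_verts k)"
  by (induction k) (auto intro: finite_lists_length_eq)

lemma Copy_in_zykov_verts: "i < k \<Longrightarrow> v \<in> zykov_verts k \<Longrightarrow> Copy i v \<in> zykov_verts (Suc k)"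
  by auto

lemma zykov_less_irrefl: "\<not> zykov_less u u"
  by (induction u) auto

lemma zykov_len_refl: "zykov_len u u = 0"
  by (induction u) auto

lemma zykov_less_trans: "zykov_less u v \<Longrightarrow> zykov_less v w \<Longrightarrow> zykov_less u w"
proof (induction u w arbitrary: v rule: zykov_less.induct)
  case (1 i u j w)
  then show ?case by (cases v) auto
next
  case (2 i u ws)
  then show ?case by (cases v) auto
qed auto

lemma zykov_len_add:
  "zykov_less u v \<Longrightarrow> zykov_less v w \<Longrightarrow> zykov_len u w = zykov_len u v + zykov_len v w"
proof (induction u w arbitrary: v rule: zykov_less.induct)
  case (1 i u j w)
  then show ?case by (cases v) auto
next
  case (2 i u ws)
  then show ?case
    by (cases v) (auto simp: zykov_less_irrefl dest: zykov_less_trans)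
qed auto

text \<open>In a proper colouring of stage \<open>k + 1\<close> with \<open>k\<close> colours, each copy of stage \<open>k\<close> would use all of them. Then some
  apex lies above a vertex of colour \<open>i\<close> in the \<open>i\<close>-th copy, for each \<open>i\<close>, and no colour is left for it.\<close>

lemma zykov_verts_not_colourable:
  assumes "\<And>v. v \<in> zykov_verts (Suc k) \<Longrightarrow> c v < k"
  shows "\<exists>u\<in>zykov_verts (Suc k). \<exists>v\<in>zykov_verts (Suc k). zykov_less u v \<and> zykov_len u v = 1 \<and> c u = (c v :: nat)"
  using assms
proof (induction k arbitrary: c)
  case 0
  then have "Apex [] \<notin> zykov_verts (Suc 0)"
    by fastforce
  then show ?case by simp
next
  case (Suc k)
  let ?V = "zykov_verts (Suc k)"
  show ?case
  proof (rule ccontr)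
    assume no_mono: "\<not> ?thesis"
    have "\<exists>v\<in>?V. c (Copy i v) = i" if "i < Suc k" for i
    proof (rule ccontr)
      assume avoid: "\<not> ?thesis"
      \<comment> \<open>A copy that avoids colour \<open>i\<close> can be coloured with \<open>k\<close> colours, by using \<open>i\<close> in place of \<open>k\<close>.\<close>
      define d where "d v = (if c (Copy i v) = k then i else c (Copy i v))" for v
      have "d v < k" if "v \<in> ?V" for v
      proof -
        have "c (Copy i v) < Suc k"
          using \<open>i < Suc k\<close> that by (intro Suc.prems) (rule Copy_in_zykov_verts)
        moreover have "c (Copy i v) \<noteq> i"
          using avoid that by blast
        ultimately show ?thesis
          using \<open>i < Suc k\<close> by (auto simp: d_def)
      qed
      then obtain u v where "u \<in> ?V" "v \<in> ?V" "zykov_less u v" "zykov_len u v = 1" "d u = d v"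
        using Suc.IH[of d] by blast
      moreover from this have "c (Copy i u) \<noteq> i" "c (Copy i v) \<noteq> i"
        using avoid by blast+
      then have "c (Copy i u) = c (Copy i v)"
        using \<open>d u = d v\<close> by (auto simp: d_def split: if_splits)
      moreover have "zykov_less (Copy i u) (Copy i v)" "zykov_len (Copy i u) (Copy i v) = 1"
        using \<open>zykov_less u v\<close> \<open>zykov_len u v = 1\<close> by simp_all
      ultimately show False
        using no_mono \<open>i < Suc k\<close> by (meson Copy_in_zykov_verts)
    qed
    then obtain f where f: "\<And>i. i < Suc k \<Longrightarrow> f i \<in> ?V \<and> c (Copy i (f i)) = i"
      by metis
    define w where "w = Apex (map f [0..<Suc k])"
    have w: "w \<in> zykov_verts (Suc (Suc k))"
      using f unfolding zykov_verts.simps(2)[of "Suc k"] w_def by (intro UnI2 imageI) (auto simp del: upt_Suc zykov_verts.simps(2))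
    then have "c w < Suc k"
      by (rule Suc.prems)
    let ?u = "Copy (c w) (f (c w))"
    have "?u \<in> zykov_verts (Suc (Suc k))" "c ?u = c w"
      using f[OF \<open>c w < Suc k\<close>] \<open>c w < Suc k\<close> Copy_in_zykov_verts by blast+
    moreover have "map f [0..<Suc k] ! c w = f (c w)"
      using \<open>c w < Suc k\<close> by (simp del: upt_Suc)
    then have "zykov_less ?u w" "zykov_len ?u w = 1"
      using \<open>c w < Suc k\<close> by (simp_all add: w_def del: upt_Suc)
    ultimately show False
      using no_mono w by blast
  qed
qed

text \<open>A strict partial order on the whole type, with a length for comparable elements that is additive along
  chains. The values of \<open>len\<close> at other pairs, apart from the diagonal, are irrelevant.\<close>

locale length_order =
  fixes less :: "'a \<Rightarrow> 'a \<Rightarrow> bool" (infix "\<sqsubset>" 50)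
    and len :: "'a \<Rightarrow> 'a \<Rightarrow> nat"
  assumes irrefl: "\<not> u \<sqsubset> u"
    and trans: "u \<sqsubset> v \<Longrightarrow> v \<sqsubset> w \<Longrightarrow> u \<sqsubset> w"
    and len_refl: "len u u = 0"
    and len_add: "u \<sqsubset> v \<Longrightarrow> v \<sqsubset> w \<Longrightarrow> len u w = len u v + len v w"

lemma ex_length_order:
  "\<exists>(less :: nat \<Rightarrow> nat \<Rightarrow> bool) len V. length_order less len \<and> finite V \<and>
    (\<forall>c. (\<forall>v\<in>V. c v < k) \<longrightarrow> (\<exists>u\<in>V. \<exists>v\<in>V. less u v \<and> len u v = 1 \<and> c u = (c v :: nat)))"
proof (intro exI conjI allI impI)
  show "length_order (\<lambda>u v. zykov_less (from_nat u) (from_nat v)) (\<lambda>u v. zykov_len (from_nat u) (from_nat v))"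
    by unfold_locales (auto simp: zykov_less_irrefl zykov_len_refl zykov_len_add intro: zykov_less_trans)
  show "finite (to_nat ` zykov_verts (Suc k))"
    by (intro finite_imageI finite_zykov_verts)
  show "\<exists>u\<in>to_nat ` zykov_verts (Suc k). \<exists>v\<in>to_nat ` zykov_verts (Suc k).
      zykov_less (from_nat u) (from_nat v) \<and> zykov_len (from_nat u) (from_nat v) = 1 \<and> c u = c v"
    if "\<forall>v\<in>to_nat ` zykov_verts (Suc k). c v < k" for c
    using zykov_verts_not_colourable[of k "c \<circ> to_nat"] that by (fastforce simp del: zykov_verts.simps)
qed

section \<open>Colouring orders with short chains modulo a prime\<close>

text \<open>A nonempty set \<open>B\<close> of fewer than \<open>p\<close> residues has a canonical midpoint \<open>mid B\<close>, the sum of its elements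
  divided by their number, which moves along with \<open>B\<close> under translation. So the translate
  \<open>nrm B\<close> with midpoint \<open>0\<close> depends only on the translation class, and the index of the position of
  \<open>0 \<in> B\<close> in it distinguishes the translates of \<open>B\<close>.\<close>

lemma ex_translate_index:
  fixes p :: nat
  assumes "prime p"
  shows "\<exists>idx :: int set \<Rightarrow> nat.
    (\<forall>B. B \<subseteq> {0..<int p} \<and> 0 \<in> B \<and> card B < p \<longrightarrow> idx B < card B) \<and>
    (\<forall>B r. B \<subseteq> {0..<int p} \<and> 0 \<in> B \<and> card B < p \<and> \<not> int p dvd r
       \<and> 0 \<in> (\<lambda>x. (x + r) mod int p) ` B \<longrightarrow> idx ((\<lambda>x. (x + r) mod int p) ` B) \<noteq> idx B)"
proof -
  let ?p = "int p"
  have "0 < ?p"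
    using assms prime_gt_0_nat by simp
  have "\<exists>i. 0 < K \<and> K < p \<longrightarrow> (int K * i) mod ?p = 1" for K
  proof (cases "0 < K \<and> K < p")
    case True
    then have "coprime (int K) ?p"
      using assms by (metis coprime_commute coprime_int_iff dvd_imp_le not_le prime_imp_coprime)
    then obtain x y where "x * int K + y * ?p = 1"
      using bezout_int[of "int K" ?p] by auto
    then have "int K * x = 1 - y * ?p"
      by (simp add: mult.commute eq_diff_eq)
    then have "(int K * x) mod ?p = (1 - y * ?p) mod ?p"
      by simp
    also have "\<dots> = 1"
      using prime_gt_1_nat[OF assms] by (simp add: mod_diff_right_eq[symmetric])
    finally show ?thesis
      by blast
  qed auto
  then obtain inv where inv: "\<And>K. 0 < K \<Longrightarrow> K < p \<Longrightarrow> (int K * inv K) mod ?p = 1"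
    by metis
  define mid where "mid B = inv (card B) * \<Sum>B" for B :: "int set"
  define nrm where "nrm B = (\<lambda>x. (x - mid B) mod ?p) ` B" for B
  define idx where "idx B = to_nat_on (nrm B) ((- mid B) mod ?p)" for B
  have mem: "(- mid B) mod ?p \<in> nrm B" if "0 \<in> B" for B
    using imageI[OF that, of "\<lambda>x. (x - mid B) mod ?p"] by (simp add: nrm_def)
  have fin: "finite B" if "B \<subseteq> {0..<?p}" for B
    using that finite_subset by blast
  have bij: "bij_betw (to_nat_on (nrm B)) (nrm B) {..<card (nrm B)}" if "B \<subseteq> {0..<?p}" for B
    using fin[OF that] by (intro to_nat_on_finite) (simp add: nrm_def)
  have "idx B < card B" if "B \<subseteq> {0..<?p}" "0 \<in> B" for B
  proof -
    have "idx B < card (nrm B)"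
      using bij[OF that(1)] mem[OF that(2)] unfolding idx_def bij_betw_def by blast
    also have "card (nrm B) \<le> card B"
      unfolding nrm_def using fin[OF that(1)] by (rule card_image_le)
    finally show ?thesis .
  qed
  moreover have "idx C \<noteq> idx B"
    if B: "B \<subseteq> {0..<?p}" "0 \<in> B" "card B < p" and r: "\<not> ?p dvd r"
      and C_def: "C = (\<lambda>x. (x + r) mod ?p) ` B" and "0 \<in> C" for B r C
  proof -
    have inj: "inj_on (\<lambda>x. (x + r) mod ?p) B"
    proof (rule inj_onI)
      fix x y assume xy: "x \<in> B" "y \<in> B" "(x + r) mod ?p = (y + r) mod ?p"
      then have "(x + r - r) mod ?p = (y + r - r) mod ?p"
        by (metis mod_diff_left_eq)
      then show "x = y"
        using xy B(1) by (auto simp: subset_iff)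
    qed
    have C: "card C = card B" "\<Sum>C mod ?p = (\<Sum>B + int (card B) * r) mod ?p" "C \<subseteq> {0..<?p}"
    proof -
      show "card C = card B"
        unfolding C_def by (rule card_image[OF inj])
      have "\<Sum>C mod ?p = (\<Sum>x\<in>B. (x + r) mod ?p) mod ?p"
        unfolding C_def by (subst sum.reindex[OF inj]) simp
      also have "\<dots> = (\<Sum>x\<in>B. x + r) mod ?p"
        by (rule mod_sum_eq)
      finally show "\<Sum>C mod ?p = (\<Sum>B + int (card B) * r) mod ?p"
        by (simp add: sum.distrib)
      show "C \<subseteq> {0..<?p}"
        unfolding C_def using \<open>0 < ?p\<close> by auto
    qed
    have "0 < card B"
      using B fin by (auto simp: card_gt_0_iff)
    have mid: "mid C mod ?p = (mid B + r) mod ?p"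
    proof -
      have "mid C mod ?p = (inv (card B) * (\<Sum>B + int (card B) * r)) mod ?p"
        unfolding mid_def C(1) by (metis C(2) mod_mult_right_eq)
      also have "\<dots> = (mid B + (int (card B) * inv (card B)) * r) mod ?p"
        by (simp add: mid_def algebra_simps)
      also have "\<dots> = (mid B + ((int (card B) * inv (card B)) mod ?p) * r) mod ?p"
        by (metis mod_add_right_eq mod_mult_left_eq)
      finally show ?thesis
        using inv[OF \<open>0 < card B\<close> B(3)] by simp
    qed
    have "((x + r) mod ?p - mid C) mod ?p = (x - mid B) mod ?p" for x
    proof -
      have "((x + r) mod ?p - mid C) mod ?p = ((x + r) - mid C mod ?p) mod ?p"
        by (simp add: mod_simps)
      also have "\<dots> = (x - mid B) mod ?p"
        unfolding mid by (simp add: mod_simps)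
      finally show ?thesis .
    qed
    then have nrm: "nrm C = nrm B"
      unfolding nrm_def C_def[symmetric] by (simp add: C_def image_image)
    have "(- mid C) mod ?p \<noteq> (- mid B) mod ?p"
    proof
      assume "(- mid C) mod ?p = (- mid B) mod ?p"
      then have "?p dvd (- mid C) - (- mid B)"
        by (simp add: mod_eq_dvd_iff)
      moreover have "?p dvd mid C - (mid B + r)"
        using mid by (simp add: mod_eq_dvd_iff)
      ultimately have "?p dvd ((- mid C) - (- mid B)) + (mid C - (mid B + r))"
        by (rule dvd_add)
      then show False
        using r by simp
    qed
    moreover have "inj_on (to_nat_on (nrm B)) (nrm B)"
      using bij[OF B(1)] by (simp add: bij_betw_def)
    ultimately show ?thesis
      unfolding idx_def nrm using mem[OF B(2)] mem[OF \<open>0 \<in> C\<close>] nrm by (metis inj_onD)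
  qed
  ultimately show ?thesis
    by (intro exI[of _ idx]) blast
qed

context length_order
begin

text \<open>Comparable elements whose length lies in the set \<open>R\<close>. The predicate \<open>R\<close> is on integers because it will
  be used for differences.\<close>

definition linked :: "(int \<Rightarrow> bool) \<Rightarrow> 'a \<Rightarrow> 'a \<Rightarrow> bool" where
  "linked R u v \<longleftrightarrow> u \<sqsubset> v \<and> R (int (len u v)) \<or> v \<sqsubset> u \<and> R (int (len v u))"

text \<open>The cliques of the graph with adjacency \<open>linked R\<close>. Linked elements are comparable, so these are
  chains of the order.\<close>

definition chain :: "(int \<Rightarrow> bool) \<Rightarrow> 'a set \<Rightarrow> bool" where
  "chain R X \<longleftrightarrow> (\<forall>u\<in>X. \<forall>v\<in>X. u \<noteq> v \<longrightarrow> linked R u v)"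

lemma asym: "u \<sqsubset> v \<Longrightarrow> \<not> v \<sqsubset> u"
  using irrefl trans by blast

lemma chain_subset: "chain R X \<Longrightarrow> Y \<subseteq> X \<Longrightarrow> chain R Y"
  by (auto simp: chain_def)

lemma chain_ex_min:
  assumes "finite X" and "X \<noteq> {}" and "chain R X"
  shows "\<exists>q\<in>X. \<forall>x\<in>X. x \<noteq> q \<longrightarrow> q \<sqsubset> x"
  using assms
proof (induction X rule: finite_ne_induct)
  case (insert y F)
  then obtain q where q: "q \<in> F" "\<And>x. x \<in> F \<Longrightarrow> x \<noteq> q \<Longrightarrow> q \<sqsubset> x"
    using chain_subset[of R "insert y F" F] by auto
  have "y \<noteq> q"
    using q(1) insert by blast
  then have "y \<sqsubset> q \<or> q \<sqsubset> y"
    using insert.prems q(1) by (auto simp: chain_def linked_def)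
  then show ?case
  proof
    assume "y \<sqsubset> q"
    then have "y \<sqsubset> x" if "x \<in> F" for x
      using q(2)[OF that] trans by (cases "x = q") auto
    then show ?thesis
      by blast
  next
    assume "q \<sqsubset> y"
    then show ?thesis
      using q by (intro bexI[of _ q]) auto
  qed
qed simp

text \<open>On a chain the length is a difference of integer positions: measure from the least element.\<close>

lemma chain_potential:
  assumes "finite X" and "chain R X" and "X \<noteq> {}"
  shows "\<exists>q\<in>X. \<exists>f. f q = 0 \<and> (\<forall>x\<in>X. \<forall>y\<in>X. x \<sqsubset> y \<longrightarrow> f y - f x = int (len x y))"
proof -
  obtain q where q: "q \<in> X" "\<And>x. x \<in> X \<Longrightarrow> x \<noteq> q \<Longrightarrow> q \<sqsubset> x"
    using chain_ex_min[OF assms(1,3,2)] by blast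
  have "len q y = len q x + len x y" if "x \<in> X" "y \<in> X" "x \<sqsubset> y" for x y
    using that q(2)[of x] len_add[of q x y] by (cases "x = q") (auto simp: len_refl)
  then show ?thesis
    using q(1) by (intro bexI[of _ q] exI[of _ "\<lambda>x. int (len q x)"]) (auto simp: len_refl)
qed

lemma colour_chain_minima:
  fixes p M :: nat
  assumes "prime p" and "finite S" and "M < p"
    and small: "\<And>X. X \<subseteq> S \<Longrightarrow> chain (\<lambda>d. \<not> int p dvd d) X \<Longrightarrow> card X \<le> M"
    and T_def: "T = {v \<in> S. \<exists>X\<subseteq>S. chain (\<lambda>d. \<not> int p dvd d) X \<and> card X = M \<and> v \<in> X \<and> (\<forall>x\<in>X. x \<noteq> v \<longrightarrow> v \<sqsubset> x)}"
  shows "\<exists>c :: 'a \<Rightarrow> nat. (\<forall>v\<in>T. c v < Suc M choose 2) \<and>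
    (\<forall>u\<in>T. \<forall>v\<in>T. u \<sqsubset> v \<and> \<not> int p dvd int (len u v) \<longrightarrow> c u \<noteq> c v)"
proof -
  let ?p = "int p" and ?R = "\<lambda>d. \<not> int p dvd d"
  have "0 < ?p"
    using assms(1) prime_gt_0_nat by simp
  obtain idx :: "int set \<Rightarrow> nat" where
    idx_less: "\<And>B. B \<subseteq> {0..<?p} \<Longrightarrow> 0 \<in> B \<Longrightarrow> card B < p \<Longrightarrow> idx B < card B" and
    idx_neq: "\<And>B r. B \<subseteq> {0..<?p} \<Longrightarrow> 0 \<in> B \<Longrightarrow> card B < p \<Longrightarrow> \<not> ?p dvd r \<Longrightarrow>
      0 \<in> (\<lambda>x. (x + r) mod ?p) ` B \<Longrightarrow> idx ((\<lambda>x. (x + r) mod ?p) ` B) \<noteq> idx B"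
    using ex_translate_index[OF assms(1)] by metis
  define B where "B v = (\<lambda>u. int (len u v) mod ?p) ` {u \<in> T. u = v \<or> u \<sqsubset> v}" for v
  have "finite T"
    using assms(2) by (simp add: T_def)
  then have B_fin: "finite (B v)" for v
    by (simp add: B_def)
  have B_sub: "B v \<subseteq> {0..<?p}" for v
    using \<open>0 < ?p\<close> by (auto simp: B_def)
  have B_0: "0 \<in> B v" if "v \<in> T" for v
    unfolding B_def using that by (intro image_eqI[of _ _ v]) (auto simp: len_refl)
  have B_card: "card (B v) \<le> M" if "v \<in> T" for v
  proof -
    obtain X where X: "X \<subseteq> S" "chain ?R X" "card X = M" "v \<in> X" "\<And>x. x \<in> X \<Longrightarrow> x \<noteq> v \<Longrightarrow> v \<sqsubset> x"
      using \<open>v \<in> T\<close> unfolding T_def by blast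
    have "finite X"
      using X(1) assms(2) finite_subset by blast
    have "B v \<subseteq> (\<lambda>x. (- int (len v x)) mod ?p) ` X"
    proof
      fix b assume "b \<in> B v"
      then obtain u where u: "u \<in> T" "u = v \<or> u \<sqsubset> v" "b = int (len u v) mod ?p"
        by (auto simp: B_def)
      show "b \<in> (\<lambda>x. (- int (len v x)) mod ?p) ` X"
      proof (cases "u = v")
        case True
        then show ?thesis
          using u(3) X(4) by (intro image_eqI[of _ _ v]) (auto simp: len_refl)
      next
        case False
        then have "u \<sqsubset> v"
          using u(2) by simp
        have below: "u \<sqsubset> x \<and> len u x = len u v + len v x" if "x \<in> X" for x
          using \<open>u \<sqsubset> v\<close> X(5)[OF that] trans[of u v x] len_add[of u v x]
          by (cases "x = v") (auto simp: len_refl)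
        then have "u \<notin> X"
          using irrefl by blast
        have "\<not> chain ?R (insert u X)"
        proof
          assume "chain ?R (insert u X)"
          then have "card (insert u X) \<le> M"
            using X(1) u(1) by (intro small) (auto simp: T_def)
          then show False
            using \<open>u \<notin> X\<close> \<open>finite X\<close> X(3) by simp
        qed
        moreover have "chain ?R (insert u X)" if "\<forall>x\<in>X. \<not> ?p dvd int (len u x)"
        proof -
          have "linked ?R u x \<and> linked ?R x u" if "x \<in> X" for x
            using below[OF that] \<open>\<forall>x\<in>X. \<not> ?p dvd int (len u x)\<close> that unfolding linked_def by blast
          then show ?thesis
            using X(2) by (auto simp: chain_def)
        qed
        ultimately obtain x where x: "x \<in> X" "?p dvd int (len u x)"
          by blast
        then have "?p dvd int (len u v) - (- int (len v x))"
          using below[of x] by simp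
        then have "b = (- int (len v x)) mod ?p"
          unfolding u(3) by (simp only: mod_eq_dvd_iff)
        then show ?thesis
          using x(1) by blast
      qed
    qed
    then have "card (B v) \<le> card X"
      using \<open>finite X\<close> by (meson card_image_le card_mono finite_imageI le_trans)
    then show ?thesis
      using X(3) by simp
  qed
  have idx_B: "idx (B v) < card (B v)" if "v \<in> T" for v
    using B_card[OF that] assms(3) by (intro idx_less B_sub B_0 that) simp
  \<comment> \<open>An injective numbering of the pairs \<open>(i, j)\<close> with \<open>j < i\<close>, here \<open>i = card (B v)\<close>.\<close>
  define c where "c v = (card (B v) choose 2) + idx (B v)" for v
  have c_less: "c v < Suc (card (B v)) choose 2" if "v \<in> T" for v
    using idx_B[OF that] by (simp add: c_def numeral_2_eq_2)
  have "c v < Suc M choose 2" if "v \<in> T" for v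
    using c_less[OF that] binomial_right_mono[of "Suc (card (B v))" "Suc M" 2] B_card[OF that] by simp
  moreover have "c u \<noteq> c v" if uv: "u \<in> T" "v \<in> T" "u \<sqsubset> v" "\<not> ?p dvd int (len u v)" for u v
  proof -
    let ?s = "\<lambda>x. (x + int (len u v)) mod ?p"
    have sub: "?s ` B u \<subseteq> B v"
    proof
      fix b assume "b \<in> ?s ` B u"
      then obtain w where w: "w \<in> T" "w = u \<or> w \<sqsubset> u" "b = ?s (int (len w u) mod ?p)"
        by (auto simp: B_def)
      then have "w \<sqsubset> v" "len w v = len w u + len u v"
        using uv(3) trans[of w u v] len_add[of w u v] by (auto simp: len_refl)
      then show "b \<in> B v"
        unfolding B_def using w by (intro image_eqI[of _ _ w]) (auto simp: mod_simps)
    qed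
    have "inj_on ?s (B u)"
    proof (rule inj_onI)
      fix x y assume xy: "x \<in> B u" "y \<in> B u" "?s x = ?s y"
      then have "?p dvd (x + int (len u v)) - (y + int (len u v))"
        by (simp only: mod_eq_dvd_iff)
      then have "x mod ?p = y mod ?p"
        by (simp add: mod_eq_dvd_iff)
      then show "x = y"
        using xy B_sub[of u] by (auto simp: subset_iff)
    qed
    then have card_s: "card (?s ` B u) = card (B u)"
      by (rule card_image)
    then have "card (B u) \<le> card (B v)"
      using card_mono[OF B_fin sub] by simp
    then consider "card (B u) < card (B v)" | "card (B u) = card (B v)"
      by linarith
    then show ?thesis
    proof cases
      case 1
      have "c u < Suc (card (B u)) choose 2"
        by (rule c_less[OF uv(1)])
      also have "\<dots> \<le> card (B v) choose 2"
        using 1 by (intro binomial_right_mono) simp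
      also have "\<dots> \<le> c v"
        by (simp add: c_def)
      finally show ?thesis
        by simp
    next
      case 2
      then have "?s ` B u = B v"
        using card_s by (intro card_subset_eq B_fin sub) simp
      then have "idx (B v) \<noteq> idx (B u)"
        using idx_neq[of "B u" "int (len u v)"] B_sub B_0 B_card uv assms(3) by fastforce
      then show ?thesis
        using 2 by (simp add: c_def)
    qed
  qed
  ultimately show ?thesis
    by blast
qed

lemma colour_of_small_chains:
  fixes p M :: nat
  assumes "prime p" and "finite S" and "M < p"
    and "\<And>X. X \<subseteq> S \<Longrightarrow> chain (\<lambda>d. \<not> int p dvd d) X \<Longrightarrow> card X \<le> M"
  shows "\<exists>c :: 'a \<Rightarrow> nat. (\<forall>v\<in>S. c v < (M + 2) choose 3) \<and>
    (\<forall>u\<in>S. \<forall>v\<in>S. u \<sqsubset> v \<and> \<not> int p dvd int (len u v) \<longrightarrow> c u \<noteq> c v)"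
  using assms(2-)
proof (induction M arbitrary: S)
  case 0
  have "S = {}"
  proof (rule ccontr)
    assume "S \<noteq> {}"
    then obtain v where "v \<in> S"
      by blast
    then show False
      using "0.prems"(3)[of "{v}"] by (simp add: chain_def)
  qed
  then show ?case
    by simp
next
  case (Suc M)
  let ?R = "\<lambda>d. \<not> int p dvd d"
  define T where "T = {v \<in> S. \<exists>X\<subseteq>S. chain ?R X \<and> card X = Suc M \<and> v \<in> X \<and> (\<forall>x\<in>X. x \<noteq> v \<longrightarrow> v \<sqsubset> x)}"
  obtain c2 :: "'a \<Rightarrow> nat" where c2: "\<And>v. v \<in> T \<Longrightarrow> c2 v < Suc (Suc M) choose 2"
    "\<And>u v. u \<in> T \<Longrightarrow> v \<in> T \<Longrightarrow> u \<sqsubset> v \<Longrightarrow> \<not> int p dvd int (len u v) \<Longrightarrow> c2 u \<noteq> c2 v"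
    using colour_chain_minima[OF assms(1) Suc.prems(1,2,3) T_def] by blast
  have small: "card X \<le> M" if X: "X \<subseteq> S - T" "chain ?R X" for X
  proof (rule ccontr)
    assume "\<not> card X \<le> M"
    moreover have "card X \<le> Suc M"
      using X by (intro Suc.prems(3)) auto
    ultimately have card: "card X = Suc M"
      by simp
    then have "finite X" "X \<noteq> {}"
      by (auto intro: card_ge_0_finite)
    then obtain q where "q \<in> X" "\<forall>x\<in>X. x \<noteq> q \<longrightarrow> q \<sqsubset> x"
      using chain_ex_min X(2) by blast
    then have "q \<in> T"
      unfolding T_def using X card by blast
    then show False
      using X(1) \<open>q \<in> X\<close> by blast
  qed
  have "\<exists>c :: 'a \<Rightarrow> nat. (\<forall>v\<in>S - T. c v < (M + 2) choose 3) \<and>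
      (\<forall>u\<in>S - T. \<forall>v\<in>S - T. u \<sqsubset> v \<and> \<not> int p dvd int (len u v) \<longrightarrow> c u \<noteq> c v)"
    using Suc.prems(1,2) by (intro Suc.IH small) auto
  then obtain c1 :: "'a \<Rightarrow> nat" where c1: "\<And>v. v \<in> S - T \<Longrightarrow> c1 v < (M + 2) choose 3"
    "\<And>u v. u \<in> S - T \<Longrightarrow> v \<in> S - T \<Longrightarrow> u \<sqsubset> v \<Longrightarrow> \<not> int p dvd int (len u v) \<Longrightarrow> c1 u \<noteq> c1 v"
    by blast
  have pascal: "((M + 2) choose 3) + (Suc (Suc M) choose 2) = (Suc M + 2) choose 3"
    by (simp add: numeral_3_eq_3 numeral_2_eq_2)
  define c where "c v = (if v \<in> T then ((M + 2) choose 3) + c2 v else c1 v)" for v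
  have "c v < (Suc M + 2) choose 3" if "v \<in> S" for v
    using c1(1)[of v] c2(1)[of v] that unfolding c_def pascal[symmetric] by auto
  moreover have "c u \<noteq> c v" if "u \<in> S" "v \<in> S" "u \<sqsubset> v" "\<not> int p dvd int (len u v)" for u v
    using c1(1)[of u] c1(1)[of v] c1(2)[of u v] c2(2)[of u v] that by (auto simp: c_def)
  ultimately show ?case
    by blast
qed

end

section \<open>Restricting the residues to a short arc\<close>

text \<open>The residue of \<open>d\<close> modulo \<open>p\<close> is at circular distance less than \<open>n\<close> from \<open>0\<close>, but different from \<open>0\<close>.\<close>

definition near :: "nat \<Rightarrow> nat \<Rightarrow> int \<Rightarrow> bool" where
  "near p n d \<longleftrightarrow> \<not> int p dvd d \<and> (d mod int p < int n \<or> (- d) mod int p < int n)"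

lemma near_uminus: "near p n (- d) \<longleftrightarrow> near p n d"
  by (auto simp: near_def)

lemma near_1: "2 \<le> n \<Longrightarrow> 1 < p \<Longrightarrow> near p n 1"
  by (auto simp: near_def zdvd_not_zless)

lemma card_window:
  fixes x :: int
  assumes "n \<le> p"
  shows "n \<le> card {a \<in> {0..<int p}. (x - a) mod int p < int n}"
proof -
  let ?g = "\<lambda>j. (x - j) mod int p"
  have recover: "(x - ?g j) mod int p = j" if "j \<in> {0..<int n}" for j
    using that assms by (simp add: mod_diff_right_eq)
  have "inj_on ?g {0..<int n}"
    by (rule inj_on_inverseI[of _ "\<lambda>a. (x - a) mod int p"]) (rule recover)
  then have "n = card (?g ` {0..<int n})"
    by (simp add: card_image)
  also have "\<dots> \<le> card {a \<in> {0..<int p}. (x - a) mod int p < int n}"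
  proof (rule card_mono)
    show "?g ` {0..<int n} \<subseteq> {a \<in> {0..<int p}. (x - a) mod int p < int n}"
      using recover assms by auto
    show "finite {a \<in> {0..<int p}. (x - a) mod int p < int n}"
      by (rule finite_subset[of _ "{0..<int p}"]) auto
  qed
  finally show ?thesis .
qed

context length_order
begin

text \<open>All positions lie in the arc from \<open>1 - n\<close> to \<open>n - 1\<close> modulo \<open>p\<close>, and of two points \<open>a\<close> and \<open>a - n\<close> at most one
  occurs, as their circular distance is \<open>n\<close>. The function \<open>g\<close> identifies these two.\<close>

lemma chain_near_card_le:
  assumes "2 * n \<le> p" and "finite X" and "chain (near p n) X" and "0 < n"
  shows "card X \<le> n"
proof (cases "X = {}")
  case False
  let ?p = "int p"
  obtain q f where q: "q \<in> X" "f q = 0"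
    and f: "\<And>x y. x \<in> X \<Longrightarrow> y \<in> X \<Longrightarrow> x \<sqsubset> y \<Longrightarrow> f y - f x = int (len x y)"
    using chain_potential[OF assms(2,3) False] by blast
  have near: "near p n (f y - f x)" if "x \<in> X" "y \<in> X" "x \<noteq> y" for x y
  proof -
    have "x \<sqsubset> y \<and> near p n (int (len x y)) \<or> y \<sqsubset> x \<and> near p n (int (len y x))"
      using assms(3) that by (simp add: chain_def linked_def)
    then show ?thesis
    proof (elim disjE conjE)
      assume "x \<sqsubset> y" "near p n (int (len x y))"
      then show ?thesis
        using f[OF that(1,2)] by simp
    next
      assume "y \<sqsubset> x" "near p n (int (len y x))"
      then show ?thesis
        using f[OF that(2,1)] near_uminus[of p n "f x - f y"] by (metis minus_diff_eq)
    qed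
  qed
  have "0 < ?p"
    using assms by simp
  define g where "g x = (let a = f x mod ?p in if a < int n then a else a - (?p - int n))" for x
  have g_bound: "g x \<in> {0..<int n} \<and> (f x mod ?p < int n \<or> ?p - int n < f x mod ?p)" if "x \<in> X" for x
  proof (cases "x = q")
    case True
    then show ?thesis
      using q assms(4) by (simp add: g_def)
  next
    case False
    then have "near p n (f x)"
      using near[OF q(1) that] q(2) by simp
    then have "f x mod ?p < int n \<or> ?p - int n < f x mod ?p"
      by (auto simp: near_def zmod_zminus1_eq_if split: if_splits)
    then show ?thesis
      using \<open>0 < ?p\<close> pos_mod_bound[of ?p "f x"] by (auto simp: g_def Let_def)
  qed
  have "inj_on g X"
  proof (rule inj_onI, rule ccontr)
    fix x y assume xy: "x \<in> X" "y \<in> X" "g x = g y" "x \<noteq> y"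
    have same: False if "x \<in> X" "y \<in> X" "x \<noteq> y" "f x mod ?p = f y mod ?p" for x y
      using near[OF that(1-3)] that(4) by (simp add: near_def mod_eq_dvd_iff[symmetric])
    have shifted: False
      if "x \<in> X" "y \<in> X" "x \<noteq> y" "f y mod ?p = f x mod ?p + (?p - int n)" for x y
    proof -
      have "(f y - f x) mod ?p = (f y mod ?p - f x mod ?p) mod ?p"
        by (simp add: mod_simps)
      also have "f y mod ?p - f x mod ?p = ?p - int n"
        using that(4) by simp
      also have "(?p - int n) mod ?p = ?p - int n"
        using assms(1,4) by (intro mod_pos_pos_trivial) linarith+
      finally have "(f y - f x) mod ?p = ?p - int n" .
      moreover from this have "(- (f y - f x)) mod ?p = int n"
        using assms(1,4) by (simp only: zmod_zminus1_eq_if) auto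
      ultimately show False
        using near[OF that(1-3)] assms(1) by (simp add: near_def)
    qed
    show False
      using xy same[of x y] shifted[of x y] shifted[of y x]
      by (auto simp: g_def Let_def split: if_splits)
  qed
  then have "card X = card (g ` X)"
    by (simp add: card_image)
  also have "\<dots> \<le> card {0..<int n}"
    using g_bound by (intro card_mono) auto
  finally show ?thesis
    by simp
qed simp

text \<open>Double counting of the pairs of an element of \<open>X\<close> and a window of \<open>n\<close> consecutive residues that contains
  the position of the element.\<close>

lemma chain_card_le_of_near_chains:
  fixes n p m :: nat
  assumes "n \<le> p" and "finite X" and "chain (\<lambda>d. \<not> int p dvd d) X"
    and small: "\<And>Y. Y \<subseteq> X \<Longrightarrow> chain (near p n) Y \<Longrightarrow> card Y \<le> m"
  shows "card X * n \<le> p * m"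
proof (cases "X = {}")
  case False
  let ?p = "int p"
  obtain q f where q: "q \<in> X" "f q = 0"
    and f: "\<And>x y. x \<in> X \<Longrightarrow> y \<in> X \<Longrightarrow> x \<sqsubset> y \<Longrightarrow> f y - f x = int (len x y)"
    using chain_potential[OF assms(2,3) False] by blast
  define W where "W a = {x \<in> X. (f x - a) mod ?p < int n}" for a
  have "card (W a) \<le> m" if "a \<in> {0..<?p}" for a
  proof (rule small)
    have near: "near p n (f y - f x)" if "x \<in> W a" "y \<in> W a" "x \<sqsubset> y" for x y
    proof -
      have "\<not> ?p dvd f y - f x"
        using that f[of x y] assms(3) asym[of x y] irrefl by (auto simp: W_def chain_def linked_def)
      moreover have "0 < ?p"
        using \<open>a \<in> {0..<?p}\<close> by simp
      let ?s = "(f x - a) mod ?p" and ?t = "(f y - a) mod ?p"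
      have st: "0 \<le> ?s" "?s < int n" "0 \<le> ?t" "?t < int n"
        using that \<open>0 < ?p\<close> by (auto simp: W_def)
      have diff: "(f y - f x) mod ?p = (?t - ?s) mod ?p" "(- (f y - f x)) mod ?p = (?s - ?t) mod ?p"
        by (simp_all add: mod_simps)
      have "(f y - f x) mod ?p < int n \<or> (- (f y - f x)) mod ?p < int n"
      proof (cases "?s \<le> ?t")
        case True
        then have "(?t - ?s) mod ?p = ?t - ?s"
          using st assms(1) by (intro mod_pos_pos_trivial) linarith+
        then show ?thesis
          using diff(1) st by linarith
      next
        case False
        then have "(?s - ?t) mod ?p = ?s - ?t"
          using st assms(1) by (intro mod_pos_pos_trivial) linarith+
        then show ?thesis
          using diff(2) st by linarith
      qed
      ultimately show ?thesis
        by (simp add: near_def)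
    qed
    have "linked (near p n) x y" if "x \<in> W a" "y \<in> W a" "x \<noteq> y" for x y
    proof -
      have "x \<in> X" "y \<in> X"
        using that by (auto simp: W_def)
      moreover have "x \<sqsubset> y \<or> y \<sqsubset> x"
        using assms(3) that \<open>x \<in> X\<close> \<open>y \<in> X\<close> by (auto simp: chain_def linked_def)
      ultimately show ?thesis
        using near[of x y] near[of y x] that f[of x y] f[of y x] by (auto simp: linked_def)
    qed
    then show "chain (near p n) (W a)"
      by (simp add: chain_def)
  qed (auto simp: W_def)
  then have "(\<Sum>a\<in>{0..<?p}. card (W a)) \<le> (\<Sum>a\<in>{0..<?p}. m)"
    by (intro sum_mono)
  then have "(\<Sum>a\<in>{0..<?p}. card (W a)) \<le> p * m"
    by simp
  moreover have "(\<Sum>a\<in>{0..<?p}. card (W a)) = (\<Sum>x\<in>X. card {a \<in> {0..<?p}. (f x - a) mod ?p < int n})"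
    unfolding W_def using assms(2) by (intro sum_multicount_gen) auto
  moreover have "(\<Sum>x\<in>X. n) \<le> (\<Sum>x\<in>X. card {a \<in> {0..<?p}. (f x - a) mod ?p < int n})"
    by (intro sum_mono card_window assms(1))
  ultimately show ?thesis
    by simp
qed simp

text \<open>Of the two bounds combined in \<open>M\<close>, the first gives the number of colours and the second keeps the sizes
  of the sets of residues invertible modulo \<open>p\<close>.\<close>

lemma colour_of_small_near_chains:
  fixes n p m :: nat
  assumes "prime p" and "n \<le> p" and "p < 3 * n" and "m < n" and "finite S"
    and small: "\<And>X. X \<subseteq> S \<Longrightarrow> chain (near p n) X \<Longrightarrow> card X \<le> m"
  shows "\<exists>c :: 'a \<Rightarrow> nat. (\<forall>v\<in>S. c v < (3 * m + 1) choose 3) \<and>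
    (\<forall>u\<in>S. \<forall>v\<in>S. u \<sqsubset> v \<and> near p n (int (len u v)) \<longrightarrow> c u \<noteq> c v)"
proof (cases "m = 0")
  case True
  have "S = {}"
  proof (rule ccontr)
    assume "S \<noteq> {}"
    then obtain v where "v \<in> S"
      by blast
    then show False
      using small[of "{v}"] True by (simp add: chain_def)
  qed
  then show ?thesis
    by simp
next
  case False
  define M where "M = min (3 * m - 1) (p - 1)"
  have "0 < p"
    using assms(1) prime_gt_0_nat by blast
  have "card X \<le> M" if X: "X \<subseteq> S" "chain (\<lambda>d. \<not> int p dvd d) X" for X
  proof -
    have "finite X"
      using X(1) assms(5) finite_subset by blast
    then have le: "card X * n \<le> p * m"
      using X small by (intro chain_card_le_of_near_chains assms(2)) auto
    also have "p * m < (3 * m) * n"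
      using False assms(3) by simp
    finally have "card X < 3 * m"
      by simp
    moreover have "p * m < p * n"
      using \<open>0 < p\<close> assms(4) by simp
    with le have "card X < p"
      by (metis le_less_trans mult.commute mult_less_cancel1)
    ultimately show ?thesis
      unfolding M_def by linarith
  qed
  moreover have "M < p"
    using \<open>0 < p\<close> by (simp add: M_def)
  ultimately obtain c :: "'a \<Rightarrow> nat" where c: "\<And>v. v \<in> S \<Longrightarrow> c v < (M + 2) choose 3"
    "\<And>u v. u \<in> S \<Longrightarrow> v \<in> S \<Longrightarrow> u \<sqsubset> v \<Longrightarrow> \<not> int p dvd int (len u v) \<Longrightarrow> c u \<noteq> c v"
    using colour_of_small_chains[OF assms(1,5), of M] by blast
  have "(M + 2) choose 3 \<le> (3 * m + 1) choose 3"
    using False by (intro binomial_right_mono) (simp add: M_def)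
  with c show ?thesis
    by (intro exI[of _ c]) (fastforce simp: near_def intro: less_le_trans)
qed

section \<open>The graph\<close>

text \<open>The edge set, on the vertices \<open>W\<close>, of the graph with adjacency \<open>linked R\<close>.\<close>

definition edges :: "(int \<Rightarrow> bool) \<Rightarrow> 'a set \<Rightarrow> 'a set set" where
  "edges R W = {{u, v} | u v. u \<in> W \<and> v \<in> W \<and> linked R u v}"

lemma linked_sym: "linked R u v \<longleftrightarrow> linked R v u"
  by (auto simp: linked_def)

lemma linked_neq: "linked R u v \<Longrightarrow> u \<noteq> v"
  using irrefl by (auto simp: linked_def)

lemma in_edges_iff: "{u, v} \<in> edges R W \<longleftrightarrow> u \<in> W \<and> v \<in> W \<and> linked R u v"
  using linked_sym by (auto simp: edges_def doubleton_eq_iff)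

lemma finite_simple_graph_edges: "finite W \<Longrightarrow> finite_simple_graph W (edges R W)"
  unfolding finite_simple_graph_def edges_def nsets_def by (auto dest: linked_neq)

lemma edges_induced: "induced_subgraph U F W (edges R W) \<Longrightarrow> U \<subseteq> W \<and> F = edges R U"
  unfolding induced_subgraph_def edges_def by auto

lemma clique_edges_iff: "K \<subseteq> W \<Longrightarrow> clique K (edges R W) \<longleftrightarrow> chain R K"
  by (auto simp: clique_def chain_def in_edges_iff)

lemma proper_colouring_edges_iff:
  "proper_colouring W (edges R W) k c \<longleftrightarrow>
    (\<forall>v\<in>W. c v < k) \<and> (\<forall>u\<in>W. \<forall>v\<in>W. u \<sqsubset> v \<and> R (int (len u v)) \<longrightarrow> c u \<noteq> c v)"
  unfolding proper_colouring_def in_edges_iff linked_def by (rule iffI; intro conjI; blast dest: not_sym)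

lemma chromatic_number_le_of_clique_number:
  fixes n p :: nat
  assumes "prime p" and "n \<le> p" and "p < 3 * n" and "finite W"
    and "clique_number W (edges (near p n) W) < n"
  shows "chromatic_number W (edges (near p n) W)
    \<le> (3 * clique_number W (edges (near p n) W) + 1) choose 3"
proof -
  let ?E = "edges (near p n) W"
  note graph = finite_simple_graph_edges[OF assms(4), of "near p n"]
  have "card X \<le> clique_number W ?E" if "X \<subseteq> W" "chain (near p n) X" for X
    using clique_number_attained(2)[OF graph that(1)] that by (simp add: clique_edges_iff)
  then obtain c :: "'a \<Rightarrow> nat" where "proper_colouring W ?E ((3 * clique_number W ?E + 1) choose 3) c"
    using colour_of_small_near_chains[OF assms(1,2,3,5,4)] unfolding proper_colouring_edges_iff by blast
  then show ?thesis
    by (rule chromatic_number_attained(2)[OF graph])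
qed

end

text \<open>Removing one vertex decreases the chromatic number by at most one, so a minimal set that contains \<open>K\<close>
  and is not colourable with \<open>k - 1\<close> colours has chromatic number \<open>k\<close>. If this set is \<open>K\<close> itself, it is colourable with \<open>k\<close> colours because
  \<open>card K \<le> k\<close>.\<close>

lemma (in length_order) ex_chromatic_number_eq:
  assumes "finite V" and "K \<subseteq> V" and "card K \<le> k" and "0 < k"
    and "\<And>c. \<not> proper_colouring V (edges R V) (k - 1) c"
  shows "\<exists>W. K \<subseteq> W \<and> W \<subseteq> V \<and> chromatic_number W (edges R W) = k"
proof -
  let ?P = "\<lambda>W. K \<subseteq> W \<and> W \<subseteq> V \<and> (\<forall>c. \<not> proper_colouring W (edges R W) (k - 1) c)"
  have "?P V"
    using assms by blast
  then obtain W where W: "?P W" and minimal: "\<And>U. ?P U \<Longrightarrow> card W \<le> card U"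
    using ex_has_least_nat[of ?P V card] by blast
  have "finite W"
    using W assms(1) finite_subset by blast
  have "\<exists>c. proper_colouring W (edges R W) k c"
  proof (cases "W = K")
    case True
    obtain h where h: "bij_betw h W {0..<card W}"
      using ex_bij_betw_finite_nat[OF \<open>finite W\<close>] by blast
    then have "proper_colouring W (edges R W) k h"
      using True assms(3) irrefl unfolding proper_colouring_edges_iff
      by (metis atLeastLessThan_iff bij_betwE bij_betw_imp_inj_on inj_onD less_le_trans)
    then show ?thesis by blast
  next
    case False
    then obtain w where w: "w \<in> W" "w \<notin> K"
      using W by blast
    have "\<not> card W \<le> card (W - {w})"
      using w(1) \<open>finite W\<close> by (meson card_Diff1_less not_le)
    then have "\<not> ?P (W - {w})"
      using minimal by blast
    then obtain c where c: "proper_colouring (W - {w}) (edges R (W - {w})) (k - 1) c"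
      using W w by blast
    have c_less: "c v < k - 1" if "v \<in> W" "v \<noteq> w" for v
      using c that unfolding proper_colouring_edges_iff by blast
    have c_neq: "c u \<noteq> c v" if "u \<in> W - {w}" "v \<in> W - {w}" "u \<sqsubset> v" "R (int (len u v))" for u v
      using c that unfolding proper_colouring_edges_iff by blast
    have "(c(w := k - 1)) v < k" if "v \<in> W" for v
      using c_less[of v] that \<open>0 < k\<close> by (cases "v = w") auto
    moreover have "(c(w := k - 1)) u \<noteq> (c(w := k - 1)) v"
      if "u \<in> W" "v \<in> W" "u \<sqsubset> v" "R (int (len u v))" for u v
      using that c_less[of u] c_less[of v] c_neq[of u v] irrefl[of u] by (cases "u = w"; cases "v = w") auto
    ultimately have "proper_colouring W (edges R W) k (c(w := k - 1))"
      unfolding proper_colouring_edges_iff by blast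
    then show ?thesis by blast
  qed
  then have "chromatic_number W (edges R W) \<le> k"
    using chromatic_number_attained(2)[OF finite_simple_graph_edges[OF \<open>finite W\<close>]] by blast
  moreover have "\<not> chromatic_number W (edges R W) \<le> k - 1"
  proof
    assume le: "chromatic_number W (edges R W) \<le> k - 1"
    obtain c where "proper_colouring W (edges R W) (chromatic_number W (edges R W)) c"
      using chromatic_number_attained(1)[OF finite_simple_graph_edges[OF \<open>finite W\<close>]] by blast
    then have "proper_colouring W (edges R W) (k - 1) c"
      using le by (auto simp: proper_colouring_def intro: less_le_trans)
    then show False
      using W by blast
  qed
  ultimately have "chromatic_number W (edges R W) = k"
    by linarith
  then show ?thesis
    using W by blast
qed

theorem theorem2:
  fixes n k :: nat
  assumes "2 \<le> n" and "n \<le> k"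
  shows "\<exists>(V :: nat set) E.
    finite_simple_graph V E \<and>
    clique_number V E = n \<and>
    chromatic_number V E = k \<and>
    (\<forall>W F m. induced_subgraph W F V E \<and> clique_number W F = m \<and> m < n \<longrightarrow>
      chromatic_number W F \<le> (3 * m + 1) choose 3)"
proof -
  obtain p where p: "prime p" "2 * n \<le> p" "p < 3 * n"
    using ex_prime_between[OF assms(1)] by blast
  then have "1 < p" "n \<le> p" "0 < n"
    using prime_gt_1_nat assms by auto
  \<comment> \<open>Large enough to force, besides chromatic number at least \<open>k\<close>, a clique of size \<open>n\<close>.\<close>
  define k' where "k' = max k ((3 * n + 1) choose 3)"
  obtain less :: "nat \<Rightarrow> nat \<Rightarrow> bool" and len V where ord: "length_order less len" and "finite V"
    and mono: "\<And>c. (\<forall>v\<in>V. c v < k') \<Longrightarrow> \<exists>u\<in>V. \<exists>v\<in>V. less u v \<and> len u v = 1 \<and> c u = (c v :: nat)"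
    using ex_length_order[of k'] by metis
  interpret length_order less len
    by (rule ord)
  let ?R = "near p n"
  have not_colourable: "\<not> proper_colouring V (edges ?R V) j c" if "j \<le> k'" for j c
  proof
    assume "proper_colouring V (edges ?R V) j c"
    then have c: "\<forall>v\<in>V. c v < j" "\<And>u v. u \<in> V \<Longrightarrow> v \<in> V \<Longrightarrow> less u v \<Longrightarrow> ?R (int (len u v)) \<Longrightarrow> c u \<noteq> c v"
      unfolding proper_colouring_edges_iff by blast+
    have "\<forall>v\<in>V. c v < k'"
      using c(1) that by (meson less_le_trans)
    then obtain u v where "u \<in> V" "v \<in> V" "less u v" "len u v = 1" "c u = c v"
      using mono by blast
    then show False
      using c(2)[of u v] near_1[OF assms(1) \<open>1 < p\<close>] by simp
  qed
  have clique_le: "clique_number W (edges ?R W) \<le> n" if fin: "finite W" for W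
  proof -
    obtain K where "K \<subseteq> W" "clique K (edges ?R W)" "card K = clique_number W (edges ?R W)"
      using clique_number_attained(1)[OF finite_simple_graph_edges[OF fin]] by blast
    then show ?thesis
      using chain_near_card_le[OF p(2) finite_subset[OF _ fin] _ \<open>0 < n\<close>, of K]
      by (simp add: clique_edges_iff)
  qed
  have "clique_number V (edges ?R V) = n"
  proof (rule ccontr)
    assume "clique_number V (edges ?R V) \<noteq> n"
    then have less: "clique_number V (edges ?R V) < n"
      using clique_le[OF \<open>finite V\<close>] by simp
    have "chromatic_number V (edges ?R V) \<le> (3 * clique_number V (edges ?R V) + 1) choose 3"
      by (rule chromatic_number_le_of_clique_number[OF p(1) \<open>n \<le> p\<close> p(3) \<open>finite V\<close> less])
    also have "\<dots> \<le> (3 * n + 1) choose 3"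
      using less by (intro binomial_right_mono) simp
    also have "\<dots> \<le> k'"
      by (simp add: k'_def)
    finally show False
      using not_colourable chromatic_number_attained(1)[OF finite_simple_graph_edges[OF \<open>finite V\<close>]] by blast
  qed
  then obtain K where K: "K \<subseteq> V" "chain ?R K" "card K = n"
    using clique_number_attained(1)[OF finite_simple_graph_edges[OF \<open>finite V\<close>], of ?R]
    by (auto simp: clique_edges_iff)
  have "0 < k" "k - 1 \<le> k'" "card K \<le> k"
    using assms K(3) by (auto simp: k'_def)
  then obtain W where W: "K \<subseteq> W" "W \<subseteq> V" "chromatic_number W (edges ?R W) = k"
    using ex_chromatic_number_eq[OF \<open>finite V\<close> K(1) _ _ not_colourable] by blast
  have "finite W"
    using W(2) \<open>finite V\<close> finite_subset by blast
  note graph = finite_simple_graph_edges[OF \<open>finite W\<close>, of ?R]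
  have "n \<le> clique_number W (edges ?R W)"
    using clique_number_attained(2)[OF graph W(1)] K W(1) by (simp add: clique_edges_iff)
  then have "clique_number W (edges ?R W) = n"
    using clique_le[OF \<open>finite W\<close>] by simp
  moreover have "chromatic_number U F \<le> (3 * m + 1) choose 3"
    if "induced_subgraph U F W (edges ?R W)" "clique_number U F = m" "m < n" for U F m
  proof -
    have "U \<subseteq> W" "F = edges ?R U"
      using edges_induced[OF that(1)] by auto
    moreover from this have "finite U"
      using \<open>finite W\<close> finite_subset by blast
    ultimately show ?thesis
      using chromatic_number_le_of_clique_number[OF p(1) \<open>n \<le> p\<close> p(3), of U] that by simp
  qed
  ultimately show ?thesis
    using graph W(3) by blast
qed

end
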